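(* Let the random autoregressive coefficient satisfy the mixing density condition with parameter $\beta>2$ and assume $\mathrm E\varepsilon^4(0)<\infty$. Let $t\in\mathbb Z$ and $$S^{t,0}_{N,n}(\tau):=\sum_{i=1}^N\sum_{u=1}^{\lfloor n\tau\rfloor}X_i(u)X_i(u+t),\qquad\tau\ge0.$$ Then, as $N,n\to\infty$ in an arbitrary way, $$n^{-1}N^{-1/2}\big(S^{t,0}_{N,n}(\tau)-\mathrm E S^{t,0}_{N,n}(\tau)\big)\to_{\rm fdd}\tau\,\sigma^*_tZ,$$ where $Z\sim N(0,1)$ and $(\sigma^*_t)^2:=\operatorname{var}\big(a^{|t|}/(1-a^2)\big)$.
   Context: Panel model. For $i\in\mathbb Z$, let $\{\varepsilon_i(t),t\in\mathbb Z\}$ be i.i.d. random variables with mean $0$ and variance $1$ (common law that of $\varepsilon(0)$), independent over $i$, and let $a_i\in[0,1)$, $i\in\mathbb Z$, be i.i.d. copies of a random variable $a$, independent of all innovations. $X_i$ is the stationary solution of $X_i(t)=a_iX_i(t-1)+\varepsilon_i(t)$, i.e. $X_i(t)=\sum_{u\le t}a_i^{t-u}\varepsilon_i(u)$, $t\in\mathbb Z$; the processes $X_i$, $i\in\mathbb Z$, are i.i.d. Mixing density condition with parameter $\beta>0$: $a$ has a density $\phi(x)=\psi(x)(1-x)^{\beta-1}$, $x\in[0,1)$, where $\psi$ is bounded on $[0,1)$ and $\psi(1):=\lim_{x\uparrow1}\psi(x)>0$ exists. $\to_{\rm fdd}$ denotes weak convergence of finite-dimensional distributions (of processes indexed by $\tau\ge0$).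 *)

theory Defs
  imports "HOL-Probability.Probability"
begin

text \<open>Weak convergence along an arbitrary filter, so that double-indexed families are covered
  as well as sequences; the test functions are the bounded continuous ones.\<close>

definition weakly_converges ::
    "'b topology \<Rightarrow> 'i filter \<Rightarrow> ('i \<Rightarrow> 'b measure) \<Rightarrow> 'b measure \<Rightarrow> bool" where
  "weakly_converges T F \<mu> \<nu> \<longleftrightarrow>
     (\<forall>f::'b \<Rightarrow> real. continuous_map T euclideanreal f \<longrightarrow> bounded (f ` topspace T) \<longrightarrow>
        ((\<lambda>k. \<integral>x. f x \<partial>\<mu> k) \<longlongrightarrow> (\<integral>x. f x \<partial>\<nu>)) F)"

definition fdd_law :: "'a measure \<Rightarrow> real set \<Rightarrow> (real \<Rightarrow> 'a \<Rightarrow> real) \<Rightarrow> (real \<Rightarrow> real) measure" where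
  "fdd_law M J Y = distr M (PiM J (\<lambda>_. borel)) (\<lambda>\<omega>. \<lambda>\<tau>\<in>J. Y \<tau> \<omega>)"

text \<open>The limit process may live on a different probability space.\<close>

definition fdd_converges ::
    "real set \<Rightarrow> 'i filter \<Rightarrow> 'a measure \<Rightarrow> ('i \<Rightarrow> real \<Rightarrow> 'a \<Rightarrow> real) \<Rightarrow>
     'b measure \<Rightarrow> (real \<Rightarrow> 'b \<Rightarrow> real) \<Rightarrow> bool" where
  "fdd_converges T F M Y M' Y' \<longleftrightarrow>
     (\<forall>J. finite J \<longrightarrow> J \<subseteq> T \<longrightarrow>
        weakly_converges (product_topology (\<lambda>_. euclideanreal) J) F
          (\<lambda>k. fdd_law M J (Y k)) (fdd_law M' J Y'))"

text \<open>\<open>\<epsilon>0\<close> and \<open>a0\<close> are generic variables carrying the common laws; nothing is assumed about their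
  joint law with the panel. Independence of all the innovations \<open>\<epsilon> i u\<close> and all the coefficients
  \<open>a i\<close> is stated for the single combined family.\<close>

locale panel_model = prob_space M
  for M :: "'a measure" +
  fixes \<epsilon> :: "int \<Rightarrow> int \<Rightarrow> 'a \<Rightarrow> real" and a :: "int \<Rightarrow> 'a \<Rightarrow> real"
    and \<epsilon>0 :: "'a \<Rightarrow> real" and a0 :: "'a \<Rightarrow> real"
  assumes innovation_rv: "random_variable borel \<epsilon>0"
    and coefficient_rv: "random_variable borel a0"
    and independent:
      "indep_vars (\<lambda>_. borel) (case_sum a (\<lambda>(i, u). \<epsilon> i u)) (UNIV :: (int + int \<times> int) set)"
    and innovation_law: "distr M borel (\<epsilon> i u) = distr M borel \<epsilon>0"
    and coefficient_law: "distr M borel (a i) = distr M borel a0"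
    and coefficient_range: "\<omega> \<in> space M \<Longrightarrow> a i \<omega> \<in> {0..<1}"
    and generic_coefficient_range: "\<omega> \<in> space M \<Longrightarrow> a0 \<omega> \<in> {0..<1}"
    and innovation_integrable: "integrable M \<epsilon>0"
    and innovation_mean: "expectation \<epsilon>0 = 0"
    and innovation_variance: "variance \<epsilon>0 = 1"

definition mixing_density :: "'a measure \<Rightarrow> ('a \<Rightarrow> real) \<Rightarrow> real \<Rightarrow> bool" where
  "mixing_density M a \<beta> \<longleftrightarrow> \<beta> > 0 \<and>
     (\<exists>\<psi> :: real \<Rightarrow> real.
        (\<forall>x\<in>{0..<1}. 0 \<le> \<psi> x) \<and> bounded (\<psi> ` {0..<1}) \<and>
        (\<exists>\<psi>1 > 0. (\<psi> \<longlongrightarrow> \<psi>1) (at_left 1)) \<and>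
        distributed M lborel a
          (\<lambda>x. ennreal (\<psi> x * (1 - x) powr (\<beta> - 1) * indicator {0..<1} x)))"

text \<open>The sum over all \<open>u \<le> t\<close>, reindexed by \<open>k = t - u\<close>. In a \<open>panel_model\<close> it converges
  absolutely almost surely; on the exceptional null set \<open>suminf\<close> takes an irrelevant value.\<close>

definition panel_X ::
    "(int \<Rightarrow> int \<Rightarrow> 'a \<Rightarrow> real) \<Rightarrow> (int \<Rightarrow> 'a \<Rightarrow> real) \<Rightarrow> int \<Rightarrow> int \<Rightarrow> 'a \<Rightarrow> real" where
  "panel_X \<epsilon> a i t \<omega> = (\<Sum>k. a i \<omega> ^ k * \<epsilon> i (t - int k) \<omega>)"

definition lagged_product_sum ::
    "(int \<Rightarrow> int \<Rightarrow> 'a \<Rightarrow> real) \<Rightarrow> int \<Rightarrow> nat \<Rightarrow> nat \<Rightarrow> real \<Rightarrow> 'a \<Rightarrow> real" where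
  "lagged_product_sum X t N n \<tau> \<omega> =
     (\<Sum>i\<in>{1..int N}. \<Sum>u\<in>{1..\<lfloor>real n * \<tau>\<rfloor>}. X i u \<omega> * X i (u + t) \<omega>)"

end

theory Submission
  imports Defs
begin

text \<open>Write \<open>W\<^sub>i = a\<^sub>i^\<bar>t\<bar> / (1 - a\<^sub>i\<^sup>2)\<close> for the conditional mean of \<open>X\<^sub>i(u) X\<^sub>i(u + t)\<close> given
  \<open>a\<^sub>i\<close>; since \<open>\<beta> > 2\<close>, it is square integrable, and the classical central limit theorem applies to
  \<open>W\<^sub>1 + \<dots> + W\<^sub>N\<close>. The remaining fluctuation \<open>\<Sum>u\<le>m. X\<^sub>i(u) X\<^sub>i(u + t) - W\<^sub>i\<close> is independent over \<open>i\<close>, so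
  it is negligible as soon as its second moment is \<open>o(m\<^sup>2)\<close>. To see this without conditioning,
  truncate the moving averages at lag \<open>K\<close>: the error is small in \<open>L\<^sup>2\<close> uniformly in \<open>u\<close>, by a fourth
  moment bound in terms of \<open>E (1 - a\<^sup>2)\<^sup>-\<^sup>2\<close>, while the truncated fluctuation is a combination of
  \<open>K\<^sup>2\<close> sums of \<open>m\<close> pairwise uncorrelated products of innovations, weighted by powers of
  \<open>a\<^sub>i \<in> [0, 1)\<close>, hence \<open>O(m)\<close> in second moment. All limits are then linear in \<open>\<tau>\<close> up to an
  \<open>L\<^sup>2\<close>-small error, which reduces convergence of the finite-dimensional distributions to the
  scalar limit theorem.\<close>

subsection \<open>A Slutsky argument for finite-dimensional distributions\<close>

text \<open>The condition \<open>\<beta> > 2\<close> is exactly what makes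
  \<open>1 / (1 - a ^ 2) ^ 2\<close> integrable: against the density it behaves like
  \<open>(1 - x) powr (\<beta> - 3)\<close> near 1. As \<open>a\<close> may come arbitrarily close
  to 1, the moving averages have no common geometric rate, and the truncation error is made small by
  dominated convergence, without a rate. This dictates the order of choices: the tolerance
  \<open>\<delta>\<close>, then the lag \<open>K\<close>, then a constant \<open>C\<close> depending
  on \<open>K\<close>, and \<open>n\<close> last, in a bound \<open>\<delta> * m ^ 2 + C * m\<close>
  for one unit. Independence over units multiplies this bound by \<open>N\<close>, and the squared
  normalization divides by \<open>N\<close> again; the estimate is uniform in \<open>N\<close>,
  which is why \<open>N\<close> and \<open>n\<close> may grow in an arbitrary way. In place of
  conditional moments given \<open>a\<close>, expectations carry a power of \<open>a\<close> as
  weight, so that each step only needs a fresh innovation to be independent of the variables already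
  present.\<close>

text \<open>Rounding every coordinate down to the grid of mesh \<open>1 / (k + 1)\<close> factors
  \<open>f\<close> through a discrete space, where measurability is automatic; continuity makes
  \<open>f\<close> the pointwise limit of these discretizations. This links the product topology in
  the definition of weak convergence to the product sigma-algebra.\<close>

lemma continuous_map_product_borel_measurable:
  fixes f :: "('i \<Rightarrow> real) \<Rightarrow> real"
  assumes J: "finite J"
    and f: "continuous_map (product_topology (\<lambda>_. euclideanreal) J) euclideanreal f"
  shows "f \<in> borel_measurable (PiM J (\<lambda>_. borel))"
proof -
  define fl where "fl k x = (\<lambda>\<tau>\<in>J. \<lfloor>real (Suc k) * x \<tau>\<rfloor>)" for k :: nat and x :: "'i \<Rightarrow> real"
  define g where "g k z = (\<lambda>\<tau>\<in>J. real_of_int (z \<tau>) / real (Suc k))" for k :: nat and z :: "'i \<Rightarrow> int"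
  have fl: "fl k \<in> measurable (PiM J (\<lambda>_. borel)) (count_space (PiE J (\<lambda>_. UNIV)))" for k
  proof -
    have "fl k \<in> measurable (PiM J (\<lambda>_. borel)) (PiM J (\<lambda>_. count_space UNIV))"
      unfolding fl_def by measurable
    \<comment> \<open>Rounding to integers pays off here: a finite product of countable discrete
      spaces is again discrete.\<close>
    also have "PiM J (\<lambda>_. count_space UNIV) = count_space (PiE J (\<lambda>_. UNIV :: int set))"
      using J by (intro count_space_PiM_finite) auto
    finally show ?thesis .
  qed
  have approx: "(\<lambda>k. f (g k (fl k x))) \<longlonglongrightarrow> f x" if x: "x \<in> space (PiM J (\<lambda>_. borel))" for x
  proof -
    have "(\<lambda>k. real_of_int \<lfloor>real (Suc k) * y\<rfloor> / real (Suc k)) \<longlonglongrightarrow> y" for y :: real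
    proof (rule tendsto_sandwich)
      show "(\<lambda>k. y - 1 / real (Suc k)) \<longlonglongrightarrow> y"
        using tendsto_diff[OF tendsto_const LIMSEQ_inverse_real_of_nat, of y]
        by (simp add: field_simps)
      have "y - 1 / real (Suc k) \<le> real_of_int \<lfloor>real (Suc k) * y\<rfloor> / real (Suc k)" for k
      proof -
        have "real (Suc k) * y - 1 \<le> real_of_int \<lfloor>real (Suc k) * y\<rfloor>" by linarith
        then have "(real (Suc k) * y - 1) / real (Suc k) \<le> real_of_int \<lfloor>real (Suc k) * y\<rfloor> / real (Suc k)"
          by (rule divide_right_mono) simp
        then show ?thesis by (simp add: diff_divide_distrib del: of_nat_Suc)
      qed
      then show "\<forall>\<^sub>F k in sequentially. y - 1 / real (Suc k) \<le> real_of_int \<lfloor>real (Suc k) * y\<rfloor> / real (Suc k)"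
        by simp
      have "real_of_int \<lfloor>real (Suc k) * y\<rfloor> / real (Suc k) \<le> y" for k
      proof -
        have "real_of_int \<lfloor>real (Suc k) * y\<rfloor> / real (Suc k) \<le> (real (Suc k) * y) / real (Suc k)"
          by (rule divide_right_mono) simp_all
        then show ?thesis by (simp del: of_nat_Suc)
      qed
      then show "\<forall>\<^sub>F k in sequentially. real_of_int \<lfloor>real (Suc k) * y\<rfloor> / real (Suc k) \<le> y"
        by simp
    qed simp
    then have "limitin (product_topology (\<lambda>_. euclideanreal) J) (\<lambda>k. g k (fl k x)) x sequentially"
      unfolding limitin_componentwise using x
      by (auto simp: g_def fl_def space_PiM PiE_def)
    from continuous_map_limit[OF f this] show ?thesis by (simp add: o_def)
  qed
  have "(\<lambda>x. f (g k (fl k x))) \<in> borel_measurable (PiM J (\<lambda>_. borel))" for k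
    by (rule measurable_compose[OF fl]) simp
  with approx show ?thesis
    by (rule borel_measurable_LIMSEQ_real[where u = "\<lambda>k x. f (g k (fl k x))"])
qed

text \<open>The points \<open>c * v\<close> with \<open>\<bar>v\<bar> \<le> B\<close> form a compact
  segment, and continuity is uniform near a compact set: one \<open>\<eta>\<close> serves all
  \<open>v\<close>, although \<open>x\<close> itself is not confined to the segment. A sequence of
  counterexamples would have a subsequence converging to a point of the segment.\<close>

lemma continuous_map_product_modulus_on_line:
  fixes f :: "('i \<Rightarrow> real) \<Rightarrow> real" and c :: "'i \<Rightarrow> real"
  assumes f: "continuous_map (product_topology (\<lambda>_. euclideanreal) J) euclideanreal f"
    and \<delta>: "\<delta> > 0"
  shows "\<exists>\<eta>>0. \<forall>x\<in>extensional J. \<forall>v. \<bar>v\<bar> \<le> B \<longrightarrow> (\<forall>\<tau>\<in>J. \<bar>x \<tau> - c \<tau> * v\<bar> < \<eta>) \<longrightarrow>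
           \<bar>f x - f (\<lambda>\<tau>\<in>J. c \<tau> * v)\<bar> < \<delta>"
proof (rule ccontr)
  assume neg: "\<not> ?thesis"
  have "\<exists>x v. x \<in> extensional J \<and> \<bar>v\<bar> \<le> B \<and> (\<forall>\<tau>\<in>J. \<bar>x \<tau> - c \<tau> * v\<bar> < inverse (real (Suc k))) \<and>
           \<bar>f x - f (\<lambda>\<tau>\<in>J. c \<tau> * v)\<bar> \<ge> \<delta>" for k
  proof -
    have "inverse (real (Suc k)) > 0" by simp
    then show ?thesis using neg by (meson not_less)
  qed
  then obtain x v where x: "\<And>k. x k \<in> extensional J" and v: "\<And>k. \<bar>v k\<bar> \<le> B"
    and close: "\<And>k \<tau>. \<tau> \<in> J \<Longrightarrow> \<bar>x k \<tau> - c \<tau> * v k\<bar> < inverse (real (Suc k))"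
    and far: "\<And>k. \<bar>f (x k) - f (\<lambda>\<tau>\<in>J. c \<tau> * v k)\<bar> \<ge> \<delta>"
    by metis
  have "compact {-B..B}" by simp
  moreover have "\<forall>k. v k \<in> {-B..B}" using v by (auto simp: abs_le_iff minus_le_iff)
  ultimately obtain w r where r: "strict_mono (r :: nat \<Rightarrow> nat)" and w: "(v \<circ> r) \<longlonglongrightarrow> w"
    unfolding compact_def by blast
  have cv: "(\<lambda>k. c \<tau> * v (r k)) \<longlonglongrightarrow> c \<tau> * w" for \<tau>
    using w by (intro tendsto_intros) (simp add: o_def)
  have xlim: "(\<lambda>k. x (r k) \<tau>) \<longlonglongrightarrow> c \<tau> * w" if "\<tau> \<in> J" for \<tau>
  proof -
    have "(\<lambda>k. x (r k) \<tau> - c \<tau> * v (r k)) \<longlonglongrightarrow> 0"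
    proof (rule Lim_null_comparison)
      show "\<forall>\<^sub>F k in sequentially. norm (x (r k) \<tau> - c \<tau> * v (r k)) \<le> inverse (real (Suc (r k)))"
        using close[OF that] by (auto intro!: always_eventually less_imp_le)
      show "(\<lambda>k. inverse (real (Suc (r k)))) \<longlonglongrightarrow> 0"
        using LIMSEQ_subseq_LIMSEQ[OF LIMSEQ_inverse_real_of_nat r] by (simp add: o_def)
    qed
    from tendsto_add[OF this cv[of \<tau>]] show ?thesis by simp
  qed
  let ?T = "product_topology (\<lambda>_. euclideanreal) J"
  let ?l = "\<lambda>\<tau>\<in>J. c \<tau> * w"
  have "limitin ?T (\<lambda>k. x (r k)) ?l sequentially"
    unfolding limitin_componentwise using x xlim by (auto simp: PiE_def)
  from continuous_map_limit[OF f this] have 1: "(\<lambda>k. f (x (r k))) \<longlonglongrightarrow> f ?l" by (simp add: o_def)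
  have "limitin ?T (\<lambda>k. \<lambda>\<tau>\<in>J. c \<tau> * v (r k)) ?l sequentially"
    unfolding limitin_componentwise using cv by (auto simp: PiE_def)
  from continuous_map_limit[OF f this] have 2: "(\<lambda>k. f (\<lambda>\<tau>\<in>J. c \<tau> * v (r k))) \<longlonglongrightarrow> f ?l"
    by (simp add: o_def)
  have "(\<lambda>k. \<bar>f (x (r k)) - f (\<lambda>\<tau>\<in>J. c \<tau> * v (r k))\<bar>) \<longlonglongrightarrow> \<bar>f ?l - f ?l\<bar>"
    by (intro tendsto_intros 1 2)
  then have "\<delta> \<le> \<bar>f ?l - f ?l\<bar>"
    by (rule LIMSEQ_le_const) (use far in auto)
  with \<delta> show False by simp
qed

text \<open>Off an event of small probability, \<open>V k\<close> stays in a bounded range and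
  \<open>Y k\<close> stays close to the line, where the uniform modulus applies. The exceptional
  event is controlled by second moments, as in Chebyshev's inequality.\<close>

lemma (in prob_space) L2_close_imp_expectation_close:
  fixes f :: "('i \<Rightarrow> real) \<Rightarrow> real" and c :: "'i \<Rightarrow> real"
    and Y :: "'k \<Rightarrow> 'i \<Rightarrow> 'a \<Rightarrow> real" and V :: "'k \<Rightarrow> 'a \<Rightarrow> real"
  assumes J: "finite J"
    and f: "continuous_map (product_topology (\<lambda>_. euclideanreal) J) euclideanreal f"
    and C: "\<And>x. x \<in> extensional J \<Longrightarrow> \<bar>f x\<bar> \<le> C"
    and V[measurable]: "\<And>k. V k \<in> borel_measurable M"
    and Y[measurable]: "\<And>k \<tau>. Y k \<tau> \<in> borel_measurable M"
    and V2: "\<And>k. integrable M (\<lambda>\<omega>. (V k \<omega>)\<^sup>2)" "\<And>k. expectation (\<lambda>\<omega>. (V k \<omega>)\<^sup>2) \<le> K"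
    and D2: "\<And>k \<tau>. \<tau> \<in> J \<Longrightarrow> integrable M (\<lambda>\<omega>. (Y k \<tau> \<omega> - c \<tau> * V k \<omega>)\<^sup>2)"
    and D2_lim: "\<And>\<tau>. \<tau> \<in> J \<Longrightarrow> ((\<lambda>k. expectation (\<lambda>\<omega>. (Y k \<tau> \<omega> - c \<tau> * V k \<omega>)\<^sup>2)) \<longlongrightarrow> 0) F"
  shows "((\<lambda>k. expectation (\<lambda>\<omega>. f (\<lambda>\<tau>\<in>J. Y k \<tau> \<omega>))
              - expectation (\<lambda>\<omega>. f (\<lambda>\<tau>\<in>J. c \<tau> * V k \<omega>))) \<longlongrightarrow> 0) F"
proof (rule tendstoI)
  fix e :: real assume e: "e > 0"
  have C0: "C \<ge> 0" using C[of "\<lambda>\<tau>\<in>J. 0"] by (force intro: order_trans[OF abs_ge_zero])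
  have K0: "K \<ge> 0" by (rule order_trans[OF Bochner_Integration.integral_nonneg V2(2)]) simp
  \<comment> \<open>Chosen so that \<open>2 * C * K / B ^ 2 < e / 3\<close>; the summand 1 keeps
    \<open>B\<close> positive when \<open>C * K = 0\<close>.\<close>
  define B where "B = sqrt ((1 + 2 * C * K) * 3 / e)"
  have B2: "B\<^sup>2 = (1 + 2 * C * K) * 3 / e" using e C0 K0 by (simp add: B_def)
  have B0: "B > 0" using e C0 K0 by (simp add: B_def add_pos_nonneg)
  have small: "2 * C * (K / B\<^sup>2) < e / 3"
  proof -
    have "2 * C * K * e < e * (1 + 2 * C * K)" using e by (simp add: algebra_simps)
    moreover have "1 + 2 * C * K > 0" using C0 K0 by (simp add: add_pos_nonneg)
    ultimately show ?thesis unfolding B2 using e by (simp add: field_simps)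
  qed
  obtain \<eta> where \<eta>: "\<eta> > 0"
    and mod: "\<And>x v. x \<in> extensional J \<Longrightarrow> \<bar>v\<bar> \<le> B \<Longrightarrow> (\<forall>\<tau>\<in>J. \<bar>x \<tau> - c \<tau> * v\<bar> < \<eta>) \<Longrightarrow>
      \<bar>f x - f (\<lambda>\<tau>\<in>J. c \<tau> * v)\<bar> < e / 3"
    using continuous_map_product_modulus_on_line[OF f, of "e / 3" B c] e by auto
  note [measurable] = continuous_map_product_borel_measurable[OF J f]
  have fY[measurable]: "(\<lambda>\<omega>. f (\<lambda>\<tau>\<in>J. Y k \<tau> \<omega>)) \<in> borel_measurable M" for k
    by (rule measurable_compose[of _ _ "PiM J (\<lambda>_. borel)"]) measurable
  have fV[measurable]: "(\<lambda>\<omega>. f (\<lambda>\<tau>\<in>J. c \<tau> * V k \<omega>)) \<in> borel_measurable M" for k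
    by (rule measurable_compose[of _ _ "PiM J (\<lambda>_. borel)"]) measurable
  have ifY: "integrable M (\<lambda>\<omega>. f (\<lambda>\<tau>\<in>J. Y k \<tau> \<omega>))" for k
    by (rule integrable_const_bound[of _ C]) (auto intro!: C)
  have ifV: "integrable M (\<lambda>\<omega>. f (\<lambda>\<tau>\<in>J. c \<tau> * V k \<omega>))" for k
    by (rule integrable_const_bound[of _ C]) (auto intro!: C)
  \<comment> \<open>Chebyshev's inequality in pointwise form: on the exceptional event one of the
    quotients is at least 1, so their sum dominates its indicator, and \<open>2 * C\<close> bounds
    the difference there.\<close>
  have pw: "\<bar>f (\<lambda>\<tau>\<in>J. Y k \<tau> \<omega>) - f (\<lambda>\<tau>\<in>J. c \<tau> * V k \<omega>)\<bar> \<le>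
      e / 3 + 2 * C * ((V k \<omega>)\<^sup>2 / B\<^sup>2 + (\<Sum>\<tau>\<in>J. (Y k \<tau> \<omega> - c \<tau> * V k \<omega>)\<^sup>2 / \<eta>\<^sup>2))" for k \<omega>
  proof (cases "\<bar>V k \<omega>\<bar> \<le> B \<and> (\<forall>\<tau>\<in>J. \<bar>Y k \<tau> \<omega> - c \<tau> * V k \<omega>\<bar> < \<eta>)")
    case True
    have "\<bar>f (\<lambda>\<tau>\<in>J. Y k \<tau> \<omega>) - f (\<lambda>\<tau>\<in>J. c \<tau> * V k \<omega>)\<bar> < e / 3"
      by (rule mod) (use True in auto)
    moreover have "0 \<le> 2 * C * ((V k \<omega>)\<^sup>2 / B\<^sup>2 + (\<Sum>\<tau>\<in>J. (Y k \<tau> \<omega> - c \<tau> * V k \<omega>)\<^sup>2 / \<eta>\<^sup>2))"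
      using C0 by (intro mult_nonneg_nonneg add_nonneg_nonneg sum_nonneg) auto
    ultimately show ?thesis by linarith
  next
    case False
    have nn: "0 \<le> (\<Sum>\<tau>\<in>J. (Y k \<tau> \<omega> - c \<tau> * V k \<omega>)\<^sup>2 / \<eta>\<^sup>2)" by (intro sum_nonneg) auto
    have "1 \<le> (V k \<omega>)\<^sup>2 / B\<^sup>2 + (\<Sum>\<tau>\<in>J. (Y k \<tau> \<omega> - c \<tau> * V k \<omega>)\<^sup>2 / \<eta>\<^sup>2)"
    proof (cases "\<bar>V k \<omega>\<bar> \<le> B")
      case False
      then have "B\<^sup>2 \<le> (V k \<omega>)\<^sup>2" using B0 by (simp add: abs_le_square_iff[symmetric])
      then have "1 \<le> (V k \<omega>)\<^sup>2 / B\<^sup>2" using B0 by simp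
      with nn show ?thesis by linarith
    next
      case True
      with False obtain \<sigma> where \<sigma>: "\<sigma> \<in> J" "\<eta> \<le> \<bar>Y k \<sigma> \<omega> - c \<sigma> * V k \<omega>\<bar>" by (auto simp: not_less)
      then have "\<eta>\<^sup>2 \<le> (Y k \<sigma> \<omega> - c \<sigma> * V k \<omega>)\<^sup>2"
        using \<eta> by (simp add: abs_le_square_iff[symmetric])
      then have "1 \<le> (Y k \<sigma> \<omega> - c \<sigma> * V k \<omega>)\<^sup>2 / \<eta>\<^sup>2" using \<eta> by simp
      also have "\<dots> \<le> (\<Sum>\<tau>\<in>J. (Y k \<tau> \<omega> - c \<tau> * V k \<omega>)\<^sup>2 / \<eta>\<^sup>2)"
        by (rule member_le_sum) (use \<sigma> J in auto)
      finally show ?thesis by (smt (verit) divide_nonneg_nonneg zero_le_power2)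
    qed
    then have "2 * C * 1 \<le> 2 * C * ((V k \<omega>)\<^sup>2 / B\<^sup>2 + (\<Sum>\<tau>\<in>J. (Y k \<tau> \<omega> - c \<tau> * V k \<omega>)\<^sup>2 / \<eta>\<^sup>2))"
      using C0 by (intro mult_left_mono) auto
    moreover have "\<bar>f (\<lambda>\<tau>\<in>J. Y k \<tau> \<omega>)\<bar> \<le> C" "\<bar>f (\<lambda>\<tau>\<in>J. c \<tau> * V k \<omega>)\<bar> \<le> C" by (auto intro!: C)
    ultimately show ?thesis using e by linarith
  qed
  have bound: "\<bar>expectation (\<lambda>\<omega>. f (\<lambda>\<tau>\<in>J. Y k \<tau> \<omega>)) - expectation (\<lambda>\<omega>. f (\<lambda>\<tau>\<in>J. c \<tau> * V k \<omega>))\<bar>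
      \<le> e / 3 + 2 * C * (K / B\<^sup>2) + 2 * C * (\<Sum>\<tau>\<in>J. expectation (\<lambda>\<omega>. (Y k \<tau> \<omega> - c \<tau> * V k \<omega>)\<^sup>2) / \<eta>\<^sup>2)" for k
  proof -
    have "\<bar>expectation (\<lambda>\<omega>. f (\<lambda>\<tau>\<in>J. Y k \<tau> \<omega>)) - expectation (\<lambda>\<omega>. f (\<lambda>\<tau>\<in>J. c \<tau> * V k \<omega>))\<bar>
        = \<bar>expectation (\<lambda>\<omega>. f (\<lambda>\<tau>\<in>J. Y k \<tau> \<omega>) - f (\<lambda>\<tau>\<in>J. c \<tau> * V k \<omega>))\<bar>"
      using ifY ifV by simp
    also have "\<dots> \<le> expectation (\<lambda>\<omega>. \<bar>f (\<lambda>\<tau>\<in>J. Y k \<tau> \<omega>) - f (\<lambda>\<tau>\<in>J. c \<tau> * V k \<omega>)\<bar>)"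
      by (rule integral_abs_bound)
    also have "\<dots> \<le> expectation (\<lambda>\<omega>. e / 3 + 2 * C * ((V k \<omega>)\<^sup>2 / B\<^sup>2 +
        (\<Sum>\<tau>\<in>J. (Y k \<tau> \<omega> - c \<tau> * V k \<omega>)\<^sup>2 / \<eta>\<^sup>2)))"
      using ifY ifV V2(1) D2 by (intro integral_mono pw) auto
    also have "\<dots> = e / 3 + 2 * C * (expectation (\<lambda>\<omega>. (V k \<omega>)\<^sup>2) / B\<^sup>2 +
        (\<Sum>\<tau>\<in>J. expectation (\<lambda>\<omega>. (Y k \<tau> \<omega> - c \<tau> * V k \<omega>)\<^sup>2) / \<eta>\<^sup>2))"
      using V2(1) D2 by (simp add: prob_space)
    also have "\<dots> \<le> e / 3 + 2 * C * (K / B\<^sup>2 +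
        (\<Sum>\<tau>\<in>J. expectation (\<lambda>\<omega>. (Y k \<tau> \<omega> - c \<tau> * V k \<omega>)\<^sup>2) / \<eta>\<^sup>2))"
      using V2(2)[of k] C0 by (intro add_left_mono mult_left_mono add_right_mono divide_right_mono) auto
    finally show ?thesis by (simp add: algebra_simps)
  qed
  have "((\<lambda>k. 2 * C * (\<Sum>\<tau>\<in>J. expectation (\<lambda>\<omega>. (Y k \<tau> \<omega> - c \<tau> * V k \<omega>)\<^sup>2) / \<eta>\<^sup>2)) \<longlongrightarrow>
      2 * C * (\<Sum>\<tau>\<in>J. 0 / \<eta>\<^sup>2)) F"
    using \<eta> by (intro tendsto_intros D2_lim) auto
  then have "\<forall>\<^sub>F k in F. 2 * C * (\<Sum>\<tau>\<in>J. expectation (\<lambda>\<omega>. (Y k \<tau> \<omega> - c \<tau> * V k \<omega>)\<^sup>2) / \<eta>\<^sup>2) < e / 3"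
    using e by (intro order_tendstoD(2)) auto
  then show "\<forall>\<^sub>F k in F. dist (expectation (\<lambda>\<omega>. f (\<lambda>\<tau>\<in>J. Y k \<tau> \<omega>))
      - expectation (\<lambda>\<omega>. f (\<lambda>\<tau>\<in>J. c \<tau> * V k \<omega>))) 0 < e"
  proof eventually_elim
    case (elim k)
    with bound[of k] small show ?case by (simp add: dist_real_def)
  qed
qed

text \<open>A test function of the whole vector, restricted to the line
  \<open>v \<mapsto> c * v\<close>, is a bounded continuous function of one real variable, so scalar
  weak convergence of \<open>V k\<close> suffices once \<open>Y k\<close> is replaced by
  \<open>c * V k\<close>.\<close>

lemma (in prob_space) fdd_converges_if_L2_close:
  fixes Y :: "'k \<Rightarrow> real \<Rightarrow> 'a \<Rightarrow> real" and V :: "'k \<Rightarrow> 'a \<Rightarrow> real"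
    and V' :: "'b \<Rightarrow> real"
  assumes V[measurable]: "\<And>k. V k \<in> borel_measurable M"
    and Y[measurable]: "\<And>k \<tau>. Y k \<tau> \<in> borel_measurable M"
    and V'[measurable]: "V' \<in> borel_measurable M'"
    and V2: "\<And>k. integrable M (\<lambda>\<omega>. (V k \<omega>)\<^sup>2)" "\<And>k. expectation (\<lambda>\<omega>. (V k \<omega>)\<^sup>2) \<le> K"
    and D2: "\<And>k \<tau>. \<tau> \<in> T \<Longrightarrow> integrable M (\<lambda>\<omega>. (Y k \<tau> \<omega> - c \<tau> * V k \<omega>)\<^sup>2)"
    and D2_lim: "\<And>\<tau>. \<tau> \<in> T \<Longrightarrow> ((\<lambda>k. expectation (\<lambda>\<omega>. (Y k \<tau> \<omega> - c \<tau> * V k \<omega>)\<^sup>2)) \<longlongrightarrow> 0) F"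
    and weak: "\<And>g :: real \<Rightarrow> real. continuous_on UNIV g \<Longrightarrow> bounded (range g) \<Longrightarrow>
      ((\<lambda>k. expectation (\<lambda>\<omega>. g (V k \<omega>))) \<longlongrightarrow> (\<integral>\<omega>. g (V' \<omega>) \<partial>M')) F"
  shows "fdd_converges T F M Y M' (\<lambda>\<tau> \<omega>. c \<tau> * V' \<omega>)"
  unfolding fdd_converges_def weakly_converges_def
proof (intro allI impI)
  fix J :: "real set" and f :: "(real \<Rightarrow> real) \<Rightarrow> real"
  assume J: "finite J" and JT: "J \<subseteq> T"
    and f: "continuous_map (product_topology (\<lambda>_. euclideanreal) J) euclideanreal f"
    and bdd: "bounded (f ` topspace (product_topology (\<lambda>_. euclideanreal) J))"
  from bdd obtain C where C: "\<And>x. x \<in> extensional J \<Longrightarrow> \<bar>f x\<bar> \<le> C"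
    unfolding bounded_iff by (auto simp: PiE_def)
  note fm = continuous_map_product_borel_measurable[OF J f]
  have fY: "(\<integral>x. f x \<partial>fdd_law M J (Y k)) = expectation (\<lambda>\<omega>. f (\<lambda>\<tau>\<in>J. Y k \<tau> \<omega>))" for k
    unfolding fdd_law_def by (rule integral_distr[OF _ fm]) measurable
  have fV': "(\<integral>x. f x \<partial>fdd_law M' J (\<lambda>\<tau> \<omega>. c \<tau> * V' \<omega>)) = (\<integral>\<omega>. f (\<lambda>\<tau>\<in>J. c \<tau> * V' \<omega>) \<partial>M')"
    unfolding fdd_law_def by (rule integral_distr[OF _ fm]) measurable
  define g where "g v = f (\<lambda>\<tau>\<in>J. c \<tau> * v)" for v :: real
  have "continuous_map euclideanreal (product_topology (\<lambda>_. euclideanreal) J) (\<lambda>v. \<lambda>\<tau>\<in>J. c \<tau> * v)"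
    unfolding continuous_map_componentwise
    by (auto intro!: continuous_intros simp: continuous_map_iff_continuous)
  from continuous_map_compose[OF this f] have "continuous_on UNIV g"
    by (simp add: o_def g_def[abs_def] continuous_map_iff_continuous)
  moreover have "bounded (range g)"
    unfolding bounded_iff using C by (auto simp: g_def)
  ultimately have lim: "((\<lambda>k. expectation (\<lambda>\<omega>. g (V k \<omega>))) \<longlongrightarrow> (\<integral>\<omega>. g (V' \<omega>) \<partial>M')) F"
    by (rule weak)
  have "((\<lambda>k. expectation (\<lambda>\<omega>. f (\<lambda>\<tau>\<in>J. Y k \<tau> \<omega>))
              - expectation (\<lambda>\<omega>. f (\<lambda>\<tau>\<in>J. c \<tau> * V k \<omega>))) \<longlongrightarrow> 0) F"
    by (rule L2_close_imp_expectation_close[OF J f C V Y V2]) (use D2 D2_lim JT in auto)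
  from tendsto_add[OF this lim]
  show "((\<lambda>k. \<integral>x. f x \<partial>fdd_law M J (Y k)) \<longlongrightarrow>
      (\<integral>x. f x \<partial>fdd_law M' J (\<lambda>\<tau> \<omega>. c \<tau> * V' \<omega>))) F"
    unfolding fY fV' by (simp add: g_def)
qed

subsection \<open>Moment inequalities\<close>

lemma integrable_bounded_by:
  fixes f g :: "'a \<Rightarrow> real"
  assumes "integrable M g" "f \<in> borel_measurable M" "\<And>x. x \<in> space M \<Longrightarrow> \<bar>f x\<bar> \<le> g x"
  shows "integrable M f"
  by (rule Bochner_Integration.integrable_bound[OF assms(1,2)]) (use assms(3) in \<open>auto intro!: AE_I2 intro: order_trans[OF _ abs_ge_self]\<close>)

lemma power2_sum_le_card:
  fixes f :: "'i \<Rightarrow> real"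
  shows "(\<Sum>i\<in>I. f i)\<^sup>2 \<le> real (card I) * (\<Sum>i\<in>I. (f i)\<^sup>2)"
  using Cauchy_Schwarz_ineq_sum[of "\<lambda>_. 1" f I] by simp

lemma integrable_power2_sum:
  fixes f :: "'i \<Rightarrow> 'a \<Rightarrow> real"
  assumes [measurable]: "\<And>i. i \<in> I \<Longrightarrow> f i \<in> borel_measurable M"
    and f: "\<And>i. i \<in> I \<Longrightarrow> integrable M (\<lambda>x. (f i x)\<^sup>2)"
  shows "integrable M (\<lambda>x. (\<Sum>i\<in>I. f i x)\<^sup>2)"
    and "(\<integral>x. (\<Sum>i\<in>I. f i x)\<^sup>2 \<partial>M) \<le> real (card I) * (\<Sum>i\<in>I. \<integral>x. (f i x)\<^sup>2 \<partial>M)"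
proof -
  show int: "integrable M (\<lambda>x. (\<Sum>i\<in>I. f i x)\<^sup>2)"
    by (rule integrable_bounded_by[of _ "\<lambda>x. real (card I) * (\<Sum>i\<in>I. (f i x)\<^sup>2)"])
       (use f in \<open>auto simp: power2_sum_le_card\<close>)
  have "(\<integral>x. (\<Sum>i\<in>I. f i x)\<^sup>2 \<partial>M) \<le> (\<integral>x. real (card I) * (\<Sum>i\<in>I. (f i x)\<^sup>2) \<partial>M)"
    by (rule integral_mono[OF int]) (use f in \<open>auto simp: power2_sum_le_card\<close>)
  also have "\<dots> = real (card I) * (\<Sum>i\<in>I. \<integral>x. (f i x)\<^sup>2 \<partial>M)" using f by simp
  finally show "(\<integral>x. (\<Sum>i\<in>I. f i x)\<^sup>2 \<partial>M) \<le> real (card I) * (\<Sum>i\<in>I. \<integral>x. (f i x)\<^sup>2 \<partial>M)" .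
qed

lemma abs_mult_le_power2_sum: "\<bar>x * y\<bar> \<le> x\<^sup>2 + y\<^sup>2" for x y :: real
proof -
  have "2 * \<bar>x * y\<bar> \<le> x\<^sup>2 + y\<^sup>2"
    using sum_squares_bound[of "\<bar>x\<bar>" "\<bar>y\<bar>"] by (simp add: abs_mult mult.assoc)
  then show ?thesis by linarith
qed

lemma integral_power2_sum_orthogonal:
  fixes f :: "'i \<Rightarrow> 'a \<Rightarrow> real"
  assumes I: "finite I"
    and [measurable]: "\<And>i. i \<in> I \<Longrightarrow> f i \<in> borel_measurable M"
    and f: "\<And>i. i \<in> I \<Longrightarrow> integrable M (\<lambda>x. (f i x)\<^sup>2)"
    and orth: "\<And>i j. i \<in> I \<Longrightarrow> j \<in> I \<Longrightarrow> i \<noteq> j \<Longrightarrow> (\<integral>x. f i x * f j x \<partial>M) = 0"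
  shows "(\<integral>x. (\<Sum>i\<in>I. f i x)\<^sup>2 \<partial>M) = (\<Sum>i\<in>I. \<integral>x. (f i x)\<^sup>2 \<partial>M)"
proof -
  have int: "integrable M (\<lambda>x. f i x * f j x)" if "i \<in> I" "j \<in> I" for i j
    by (rule integrable_bounded_by[of _ "\<lambda>x. (f i x)\<^sup>2 + (f j x)\<^sup>2"])
       (use that f in \<open>auto simp: abs_mult_le_power2_sum\<close>)
  have "(\<integral>x. (\<Sum>i\<in>I. f i x)\<^sup>2 \<partial>M) = (\<integral>x. (\<Sum>i\<in>I. \<Sum>j\<in>I. f i x * f j x) \<partial>M)"
    by (simp add: power2_eq_square sum_product)
  also have "\<dots> = (\<Sum>i\<in>I. \<integral>x. (\<Sum>j\<in>I. f i x * f j x) \<partial>M)"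
    by (rule Bochner_Integration.integral_sum) (auto intro!: int)
  also have "\<dots> = (\<Sum>i\<in>I. \<Sum>j\<in>I. \<integral>x. f i x * f j x \<partial>M)"
    by (intro sum.cong refl Bochner_Integration.integral_sum) (auto intro!: int)
  also have "\<dots> = (\<Sum>i\<in>I. \<Sum>j\<in>I. if j = i then \<integral>x. f i x * f i x \<partial>M else 0)"
    by (intro sum.cong refl) (auto simp: orth)
  also have "\<dots> = (\<Sum>i\<in>I. \<integral>x. (f i x)\<^sup>2 \<partial>M)"
    using I by (simp add: power2_eq_square)
  finally show ?thesis .
qed

lemma power4_add_le: "(x + y) ^ 4 \<le> 8 * x ^ 4 + 8 * y ^ 4" for x y :: real
proof -
  have "(x + y)\<^sup>2 \<le> 2 * (x\<^sup>2 + y\<^sup>2)"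
    using sum_squares_bound[of x y] by (simp add: power2_sum)
  then have "((x + y)\<^sup>2)\<^sup>2 \<le> (2 * (x\<^sup>2 + y\<^sup>2))\<^sup>2" by (rule power_mono) simp
  also have "\<dots> \<le> 4 * (2 * ((x\<^sup>2)\<^sup>2 + (y\<^sup>2)\<^sup>2))"
    using sum_squares_bound[of "x\<^sup>2" "y\<^sup>2"] by (simp add: power2_sum power_mult_distrib)
  finally show ?thesis by simp
qed

lemma integrable_power4_add:
  fixes f g :: "'a \<Rightarrow> real"
  assumes [measurable]: "f \<in> borel_measurable M" "g \<in> borel_measurable M"
    and "integrable M (\<lambda>x. f x ^ 4)" "integrable M (\<lambda>x. g x ^ 4)"
  shows "integrable M (\<lambda>x. (f x + g x) ^ 4)"
  by (rule integrable_bounded_by[of _ "\<lambda>x. 8 * f x ^ 4 + 8 * g x ^ 4"])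
     (use assms in \<open>auto simp: power4_add_le\<close>)

lemma abs_power_le_one_plus_power4:
  fixes x :: real
  assumes "j \<le> 4"
  shows "\<bar>x\<bar> ^ j \<le> 1 + x ^ 4"
proof (cases "\<bar>x\<bar> \<le> 1")
  case True
  then have "\<bar>x\<bar> ^ j \<le> 1" by (intro power_le_one) auto
  also have "\<dots> \<le> 1 + x ^ 4" by simp
  finally show ?thesis .
next
  case False
  then have "\<bar>x\<bar> ^ j \<le> \<bar>x\<bar> ^ 4" using assms by (intro power_increasing) auto
  then show ?thesis by (simp add: power_even_abs)
qed

lemma (in finite_measure) integrable_power_le_4:
  fixes f :: "'a \<Rightarrow> real"
  assumes [measurable]: "f \<in> borel_measurable M" and f: "integrable M (\<lambda>x. f x ^ 4)" and j: "j \<le> 4"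
  shows "integrable M (\<lambda>x. f x ^ j)"
  by (rule integrable_bounded_by[of _ "\<lambda>x. 1 + f x ^ 4"])
     (use f abs_power_le_one_plus_power4[OF j] in \<open>auto simp: power_abs\<close>)

lemma integrable_mult_bounded:
  fixes f g :: "'a \<Rightarrow> real"
  assumes f: "integrable M f" and [measurable]: "g \<in> borel_measurable M"
    and g: "\<And>x. x \<in> space M \<Longrightarrow> \<bar>g x\<bar> \<le> 1"
  shows "integrable M (\<lambda>x. g x * f x)"
proof (rule integrable_bounded_by[of _ "\<lambda>x. \<bar>f x\<bar>"])
  show "\<bar>g x * f x\<bar> \<le> \<bar>f x\<bar>" if "x \<in> space M" for x
    using mult_right_mono[OF g[OF that] abs_ge_zero, of "f x"] by (simp add: abs_mult)
qed (use f in auto)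

lemma integrable_power2_mult:
  fixes f g :: "'a \<Rightarrow> real"
  assumes [measurable]: "f \<in> borel_measurable M" "g \<in> borel_measurable M"
    and "integrable M (\<lambda>x. f x ^ 4)" "integrable M (\<lambda>x. g x ^ 4)"
  shows "integrable M (\<lambda>x. (f x * g x)\<^sup>2)"
proof (rule integrable_bounded_by[of _ "\<lambda>x. f x ^ 4 + g x ^ 4"])
  fix x
  show "\<bar>(f x * g x)\<^sup>2\<bar> \<le> f x ^ 4 + g x ^ 4"
    using abs_mult_le_power2_sum[of "(f x)\<^sup>2" "(g x)\<^sup>2"] by (simp add: power_mult_distrib)
qed (use assms in auto)

text \<open>Carries a moment bound that is uniform over finite truncations to the almost sure limit,
  with no need for convergence in mean.\<close>

lemma integrable_Fatou:
  fixes f :: "nat \<Rightarrow> 'a \<Rightarrow> real"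
  assumes f[measurable]: "\<And>n. integrable M (f n)" and g[measurable]: "g \<in> borel_measurable M"
    and nonneg: "\<And>n x. 0 \<le> f n x" "\<And>x. 0 \<le> g x"
    and lim: "AE x in M. (\<lambda>n. f n x) \<longlonglongrightarrow> g x"
    and bound: "\<And>n. (\<integral>x. f n x \<partial>M) \<le> c"
  shows "integrable M g" "(\<integral>x. g x \<partial>M) \<le> c"
proof -
  have c: "0 \<le> c" by (rule order_trans[OF Bochner_Integration.integral_nonneg bound]) (rule nonneg)
  have "(\<integral>\<^sup>+x. ennreal (g x) \<partial>M) = (\<integral>\<^sup>+x. liminf (\<lambda>n. ennreal (f n x)) \<partial>M)"
  proof (rule nn_integral_cong_AE)
    show "AE x in M. ennreal (g x) = liminf (\<lambda>n. ennreal (f n x))"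
      using lim
    proof eventually_elim
      case (elim x)
      then have "(\<lambda>n. ennreal (f n x)) \<longlonglongrightarrow> ennreal (g x)" by (rule tendsto_ennrealI)
      then show ?case by (intro lim_imp_Liminf[symmetric]) auto
    qed
  qed
  also have "\<dots> \<le> liminf (\<lambda>n. \<integral>\<^sup>+x. ennreal (f n x) \<partial>M)"
    by (rule nn_integral_liminf) measurable
  also have "\<dots> = liminf (\<lambda>n. ennreal (\<integral>x. f n x \<partial>M))"
    using nonneg by (subst nn_integral_eq_integral[OF f]) auto
  also have "\<dots> \<le> ennreal c"
  proof -
    have "liminf (\<lambda>n. ennreal (\<integral>x. f n x \<partial>M)) \<le> liminf (\<lambda>n::nat. ennreal c)"
      by (intro Liminf_mono always_eventually allI ennreal_leI bound)
    also have "\<dots> = ennreal c" by (simp add: Liminf_const)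
    finally show ?thesis .
  qed
  finally have *: "(\<integral>\<^sup>+x. ennreal (g x) \<partial>M) \<le> ennreal c" .
  then show "integrable M g"
    by (intro integrableI_nonneg) (use nonneg in \<open>auto simp: le_less_trans\<close>)
  from * show "(\<integral>x. g x \<partial>M) \<le> c" using c by (intro integral_real_bounded) auto
qed

lemma geometric_sum_le:
  fixes x :: real
  assumes "0 \<le> x" "x < 1"
  shows "(\<Sum>k\<in>{L..<K}. x ^ k) \<le> x ^ L / (1 - x)"
proof -
  \<comment> \<open>The \<open>max\<close> makes the telescoping identity hold also for the empty
    range \<open>K \<le> L\<close>.\<close>
  have "(1 - x) * (\<Sum>k\<in>{L..<K}. x ^ k) + x ^ max L K = x ^ L"
  proof (induction K)
    case (Suc K)
    show ?case
    proof (cases "L \<le> K")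
      case True
      with Suc have "(1 - x) * (\<Sum>k\<in>{L..<K}. x ^ k) + x ^ K = x ^ L" by (simp add: max_def)
      moreover have "(1 - x) * (s + x ^ K) + x * x ^ K = (1 - x) * s + x ^ K" for s
        by (simp add: algebra_simps)
      ultimately show ?thesis using True by (simp add: max_def)
    next
      case False
      then have "max L (Suc K) = L" "{L..<Suc K} = {}" by auto
      then show ?thesis by simp
    qed
  qed simp
  moreover have "0 \<le> x ^ max L K" using assms by simp
  ultimately have "(1 - x) * (\<Sum>k\<in>{L..<K}. x ^ k) \<le> x ^ L" by linarith
  then show ?thesis using assms by (simp add: field_simps)
qed

lemma power4_sum_expand: "(x + y) ^ 4 = x ^ 4 + 4 * (x ^ 3 * y) + 6 * (x ^ 2 * y ^ 2) + 4 * (x * y ^ 3) + y ^ 4"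
  for x y :: real
proof -
  have "(x + y) ^ 4 = (x + y)\<^sup>2 * (x + y)\<^sup>2" by (simp add: power2_eq_square power4_eq_xxxx)
  also have "\<dots> = (x\<^sup>2 + y\<^sup>2 + 2 * (x * y)) * (x\<^sup>2 + y\<^sup>2 + 2 * (x * y))" by (simp add: power2_sum mult_ac)
  also have "\<dots> = x ^ 4 + 4 * (x ^ 3 * y) + 6 * (x ^ 2 * y ^ 2) + 4 * (x * y ^ 3) + y ^ 4"
    by (simp add: power2_eq_square power4_eq_xxxx power3_eq_cube distrib_left distrib_right mult_ac)
  finally show ?thesis .
qed

text \<open>Young's inequality with a free weight: later \<open>x\<close> is a truncation tail and
  \<open>y\<close> is merely bounded in fourth moment. A small \<open>l\<close> tames the
  \<open>y\<close> term, after which the tail is made small enough to absorb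
  \<open>1 / l\<close>.\<close>

lemma weighted_square_mult_le:
  fixes x y l :: real
  assumes "l > 0"
  shows "2 * (x * y)\<^sup>2 \<le> x ^ 4 / l + l * y ^ 4"
proof -
  have "2 * (x\<^sup>2 / sqrt l) * (sqrt l * y\<^sup>2) \<le> (x\<^sup>2 / sqrt l)\<^sup>2 + (sqrt l * y\<^sup>2)\<^sup>2"
    by (rule sum_squares_bound)
  then show ?thesis using assms by (simp add: power_divide power_mult_distrib)
qed

lemma power2_sum3_le: "(x + y + z)\<^sup>2 \<le> 3 * x\<^sup>2 + 3 * y\<^sup>2 + 3 * z\<^sup>2" for x y z :: real
proof -
  have "0 \<le> (x - y)\<^sup>2 + (y - z)\<^sup>2 + (x - z)\<^sup>2" by simp
  then show ?thesis by (simp add: power2_eq_square algebra_simps)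
qed

lemma sum_int_eq_sum_nat: "(\<Sum>i\<in>{1..int N}. h i) = (\<Sum>n<N. h (int n + 1))"
  for h :: "int \<Rightarrow> 'c :: comm_monoid_add"
  by (rule sum.reindex_bij_witness[of _ "\<lambda>n. int n + 1" "\<lambda>i. nat (i - 1)"]) auto

section \<open>A negative moment under the mixing density\<close>

text \<open>Since \<open>1 - x ^ 2 \<ge> 1 - x\<close> on the unit interval, the integrand is at
  most a constant times \<open>(1 - x) powr (\<beta> - 3)\<close>, a Beta integrand with parameters
  1 and \<open>\<beta> - 2\<close>.\<close>

lemma (in prob_space) mixing_density_imp_integrable:
  assumes mix: "mixing_density M A \<beta>" and \<beta>: "\<beta> > 2"
    and A[measurable]: "A \<in> borel_measurable M"
    and range: "\<And>\<omega>. \<omega> \<in> space M \<Longrightarrow> A \<omega> \<in> {0..<1}"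
  shows "integrable M (\<lambda>\<omega>. 1 / (1 - (A \<omega>)\<^sup>2)\<^sup>2)"
proof -
  from mix obtain \<psi> where nn: "\<And>x. x \<in> {0..<1} \<Longrightarrow> 0 \<le> \<psi> x" and bdd: "bounded (\<psi> ` {0..<1})"
    and dens: "distributed M lborel A (\<lambda>x. ennreal (\<psi> x * (1 - x) powr (\<beta> - 1) * indicator {0..<1} x))"
    unfolding mixing_density_def by blast
  from bdd obtain B where B: "\<And>x. x \<in> {0..<1} \<Longrightarrow> \<bar>\<psi> x\<bar> \<le> B"
    unfolding bounded_iff by (metis imageI real_norm_def)
  have B0: "0 \<le> B" using B[of 0] by force
  let ?g = "\<lambda>x::real. 1 / (1 - x\<^sup>2)\<^sup>2"
  let ?h = "\<lambda>x::real. x powr (1 - 1) * (1 - x) powr (\<beta> - 2 - 1)"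
  have "(\<integral>\<^sup>+\<omega>. ennreal (?g (A \<omega>)) \<partial>M)
      = (\<integral>\<^sup>+x. ennreal (\<psi> x * (1 - x) powr (\<beta> - 1) * indicator {0..<1} x) * ennreal (?g x) \<partial>lborel)"
    by (rule distributed_nn_integral[OF dens, symmetric]) measurable
  also have "\<dots> \<le> (\<integral>\<^sup>+x. ennreal B * ennreal (indicator {0..1} x * ?h x) \<partial>lborel)"
  proof (rule nn_integral_mono_AE)
    show "AE x in lborel. ennreal (\<psi> x * (1 - x) powr (\<beta> - 1) * indicator {0..<1} x) * ennreal (?g x)
        \<le> ennreal B * ennreal (indicator {0..1} x * ?h x)"
      \<comment> \<open>The point 0 must be discarded: \<open>0 powr 0 = 0\<close>, so the Beta
        integrand vanishes there.\<close>
      using AE_lborel_singleton[of "0::real"]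
    proof eventually_elim
      case (elim x)
      show ?case
      proof (cases "x \<in> {0..<1}")
        case True
        then have x: "0 < x" "x < 1" using elim by auto
        have "1 - x \<le> 1 - x\<^sup>2" using x by (simp add: power2_eq_square mult_left_le_one_le)
        then have "(1 - x)\<^sup>2 \<le> (1 - x\<^sup>2)\<^sup>2" using x by (intro power_mono) auto
        then have "?g x \<le> 1 / (1 - x)\<^sup>2" using x by (intro divide_left_mono) (auto simp: zero_less_mult_iff power2_eq_square abs_square_less_1[unfolded power2_eq_square])
        also have "\<dots> = (1 - x) powr (- 2)"
          using x by (simp add: powr_minus divide_inverse powr_numeral)
        finally have g: "?g x \<le> (1 - x) powr (- 2)" .
        have "\<psi> x * (1 - x) powr (\<beta> - 1) * ?g x \<le> B * (1 - x) powr (\<beta> - 1) * (1 - x) powr (- 2)"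
          using B[OF True] nn[OF True] B0 g by (intro mult_mono) auto
        also have "\<dots> = B * ?h x"
          using x by (simp add: powr_add[symmetric] mult.assoc)
        finally have le: "\<psi> x * (1 - x) powr (\<beta> - 1) * ?g x \<le> B * ?h x" .
        have "ennreal (\<psi> x * (1 - x) powr (\<beta> - 1) * indicator {0..<1} x) * ennreal (?g x)
            = ennreal (\<psi> x * (1 - x) powr (\<beta> - 1) * ?g x)"
          using True nn[OF True] by (subst ennreal_mult[symmetric]) auto
        also have "\<dots> \<le> ennreal (B * ?h x)" by (rule ennreal_leI[OF le])
        also have "\<dots> = ennreal B * ennreal (indicator {0..1} x * ?h x)"
          using B0 x by (subst ennreal_mult[symmetric]) auto
        finally show ?thesis .
      qed simp
    qed
  qed
  also have "\<dots> = ennreal B * (\<integral>\<^sup>+x. ennreal (indicator {0..1} x * ?h x) \<partial>lborel)"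
    by (rule nn_integral_cmult) measurable
  also have "(\<integral>\<^sup>+x. ennreal (indicator {0..1} x * ?h x) \<partial>lborel) = ennreal (Beta 1 (\<beta> - 2))"
    \<comment> \<open>The second Beta parameter \<open>\<beta> - 2\<close> has to be
      positive.\<close>
    by (rule nn_integral_has_integral_lebesgue[OF _ has_integral_Beta_real]) (use \<beta> in auto)
  also have "ennreal B * ennreal (Beta 1 (\<beta> - 2)) < \<infinity>"
    by (simp add: ennreal_mult_less_top)
  finally show ?thesis
    by (intro integrableI_nonneg) auto
qed

subsection \<open>Independence in the panel\<close>

context panel_model
begin

definition panel_family :: "int + int \<times> int \<Rightarrow> 'a \<Rightarrow> real" where
  "panel_family = case_sum a (\<lambda>(i, u). \<epsilon> i u)"

lemma panel_family_simps [simp]: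
  "panel_family (Inl i) = a i" "panel_family (Inr (i, u)) = \<epsilon> i u"
  by (simp_all add: panel_family_def)

lemma measurable_panel_family [measurable]: "panel_family k \<in> borel_measurable M"
  using independent unfolding indep_vars_def panel_family_def by auto

lemma measurable_panel [measurable]:
  "a i \<in> borel_measurable M" "\<epsilon> i u \<in> borel_measurable M"
  "\<epsilon>0 \<in> borel_measurable M" "a0 \<in> borel_measurable M"
  using measurable_panel_family[of "Inl i"] measurable_panel_family[of "Inr (i, u)"]
    innovation_rv coefficient_rv by simp_all

text \<open>Generated by the panel variables with index in \<open>A\<close>. Measurability with
  respect to it says that a quantity depends on these variables only, so independence claims reduce
  to disjointness of index sets.\<close>

definition panel_sigma :: "(int + int \<times> int) set \<Rightarrow> 'a measure" where
  "panel_sigma A = vimage_algebra (space M) (\<lambda>\<omega>. \<lambda>k\<in>A. panel_family k \<omega>) (PiM A (\<lambda>_. borel))"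

lemma space_panel_sigma [simp]: "space (panel_sigma A) = space M"
  by (simp add: panel_sigma_def)

lemma panel_family_in_panel_sigma:
  assumes "k \<in> A" shows "panel_family k \<in> borel_measurable (panel_sigma A)"
proof -
  have "(\<lambda>\<omega>. \<lambda>k\<in>A. panel_family k \<omega>) \<in> measurable (panel_sigma A) (PiM A (\<lambda>_. borel))"
    unfolding panel_sigma_def
    by (rule measurable_vimage_algebra1) (auto simp: space_PiM)
  from measurable_compose[OF this measurable_component_singleton[OF assms]]
  show ?thesis using assms by simp
qed

lemma panel_sigma_coefficient: "Inl i \<in> A \<Longrightarrow> a i \<in> borel_measurable (panel_sigma A)"
  and panel_sigma_innovation: "Inr (i, u) \<in> A \<Longrightarrow> \<epsilon> i u \<in> borel_measurable (panel_sigma A)"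
  using panel_family_in_panel_sigma[of "Inl i" A] panel_family_in_panel_sigma[of "Inr (i, u)" A]
  by simp_all

lemma sets_panel_sigma:
  "sets (panel_sigma A) = {(\<lambda>\<omega>. \<lambda>k\<in>A. panel_family k \<omega>) -` B \<inter> space M |B. B \<in> sets (PiM A (\<lambda>_. borel))}"
  unfolding panel_sigma_def by (rule sets_vimage_algebra2) (auto simp: space_PiM)

text \<open>Disjoint blocks of an independent family are independent as vectors, and whatever is
  measurable with respect to a block inherits this. All later independence claims except the one for
  the central limit theorem go through this lemma.\<close>

lemma indep_var_panel_sigma:
  fixes Q R :: "'a \<Rightarrow> real"
  assumes disj: "A \<inter> B = {}"
    and Q: "Q \<in> borel_measurable (panel_sigma A)" and R: "R \<in> borel_measurable (panel_sigma B)"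
  shows "indep_var borel Q borel R"
proof -
  have meas: "H \<in> borel_measurable M" if "H \<in> borel_measurable (panel_sigma C)" for H :: "'a \<Rightarrow> real" and C
  proof -
    have "sets (panel_sigma C) \<subseteq> sets M"
    proof
      fix S assume "S \<in> sets (panel_sigma C)"
      then obtain D where "S = (\<lambda>\<omega>. \<lambda>k\<in>C. panel_family k \<omega>) -` D \<inter> space M"
        "D \<in> sets (PiM C (\<lambda>_. borel :: real measure))" unfolding sets_panel_sigma by auto
      then show "S \<in> sets M" by (auto intro!: measurable_sets[of _ M "PiM C (\<lambda>_. borel)"])
    qed
    with that show ?thesis by (auto simp: measurable_def)
  qed
  have "indep_vars (\<lambda>_. borel) panel_family (UNIV :: (int + int \<times> int) set)"
    using independent unfolding panel_family_def .
  \<comment> \<open>The sigma-algebras generated by the two restricted vectors are exactly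
    \<open>panel_sigma A\<close> and \<open>panel_sigma B\<close>.\<close>
  from indep_var_restrict[OF this disj]
  have "indep_set (sigma_sets (space M) (sets (panel_sigma A))) (sigma_sets (space M) (sets (panel_sigma B)))"
    unfolding indep_var_eq sets_panel_sigma by simp
  then have ind: "indep_set (sets (panel_sigma A)) (sets (panel_sigma B))"
    using sets.sigma_sets_eq[of "panel_sigma A"] sets.sigma_sets_eq[of "panel_sigma B"] by simp
  have sub: "sigma_sets (space M) {H -` S \<inter> space M |S. S \<in> sets borel} \<subseteq> sets (panel_sigma C)"
    if "H \<in> borel_measurable (panel_sigma C)" for H :: "'a \<Rightarrow> real" and C
  proof -
    have "{H -` S \<inter> space M |S. S \<in> sets borel} \<subseteq> sets (panel_sigma C)"
      using measurable_sets[OF that] by auto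
    from sets.sigma_sets_subset[OF this] show ?thesis by simp
  qed
  show ?thesis
    unfolding indep_var_eq
  proof (intro conjI)
    show "indep_set (sigma_sets (space M) {Q -` S \<inter> space M |S. S \<in> sets borel})
        (sigma_sets (space M) {R -` S \<inter> space M |S. S \<in> sets borel})"
      using ind unfolding indep_set_def
      by (rule indep_sets_mono_sets) (use sub[OF Q] sub[OF R] in \<open>simp split: bool.split\<close>)
  qed (rule meas[OF Q] meas[OF R])+
qed

lemma expectation_coefficient:
  "g \<in> borel_measurable borel \<Longrightarrow> expectation (\<lambda>\<omega>. g (a i \<omega>)) = (expectation (\<lambda>\<omega>. g (a0 \<omega>)) :: real)"
  by (metis integral_distr measurable_panel(1,4) coefficient_law)

lemma integrable_coefficient:
  "g \<in> borel_measurable borel \<Longrightarrow> integrable M (\<lambda>\<omega>. g (a i \<omega>) :: real) \<longleftrightarrow> integrable M (\<lambda>\<omega>. g (a0 \<omega>))"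
  by (metis integrable_distr_eq measurable_panel(1,4) coefficient_law)

lemma expectation_innovation:
  "g \<in> borel_measurable borel \<Longrightarrow> expectation (\<lambda>\<omega>. g (\<epsilon> i u \<omega>)) = (expectation (\<lambda>\<omega>. g (\<epsilon>0 \<omega>)) :: real)"
  by (metis integral_distr measurable_panel(2,3) innovation_law)

lemma integrable_innovation:
  "g \<in> borel_measurable borel \<Longrightarrow> integrable M (\<lambda>\<omega>. g (\<epsilon> i u \<omega>) :: real) \<longleftrightarrow> integrable M (\<lambda>\<omega>. g (\<epsilon>0 \<omega>))"
  by (metis integrable_distr_eq measurable_panel(2,3) innovation_law)

end

subsection \<open>Fourth moments of the moving averages\<close>

text \<open>The mixing density enters the following estimates through
  \<open>coefficient_moment\<close>, the second moment of the variance
  \<open>1 / (1 - a ^ 2)\<close> of \<open>X i u\<close> given the coefficient.\<close>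

locale panel_model_moments = panel_model +
  assumes innovation_fourth_moment: "integrable M (\<lambda>\<omega>. \<epsilon>0 \<omega> ^ 4)"
    and coefficient_moment: "integrable M (\<lambda>\<omega>. 1 / (1 - (a0 \<omega>)\<^sup>2)\<^sup>2)"
begin

definition m4 :: real where "m4 = expectation (\<lambda>\<omega>. \<epsilon>0 \<omega> ^ 4)"

text \<open>The scale of all bounds below: \<open>p = 0\<close> controls the full series, large
  \<open>p\<close> what remains after truncation.\<close>

definition weight_moment :: "nat \<Rightarrow> real" where "weight_moment p = expectation (\<lambda>\<omega>. a0 \<omega> ^ p / (1 - (a0 \<omega>)\<^sup>2)\<^sup>2)"

lemma m4_nonneg: "0 \<le> m4"
  unfolding m4_def by (rule Bochner_Integration.integral_nonneg) simp

lemma coefficient_bounds: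
  assumes "\<omega> \<in> space M"
  shows "0 \<le> a i \<omega>" "a i \<omega> < 1" "(a i \<omega>)\<^sup>2 < 1" "0 \<le> a i \<omega> ^ p" "a i \<omega> ^ p \<le> 1" "\<bar>a i \<omega> ^ p\<bar> \<le> 1"
    "0 \<le> a0 \<omega>" "a0 \<omega> < 1" "(a0 \<omega>)\<^sup>2 < 1" "0 \<le> a0 \<omega> ^ p" "a0 \<omega> ^ p \<le> 1" "\<bar>a0 \<omega> ^ p\<bar> \<le> 1"
proof -
  have *: "x\<^sup>2 < 1 \<and> 0 \<le> x ^ p \<and> x ^ p \<le> 1 \<and> \<bar>x ^ p\<bar> \<le> 1" if "0 \<le> x" "x < 1" for x :: real
    using that power_le_one[of x p] by (simp add: abs_square_less_1)
  show "0 \<le> a i \<omega>" "a i \<omega> < 1" "0 \<le> a0 \<omega>" "a0 \<omega> < 1"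
    using coefficient_range[OF assms, of i] generic_coefficient_range[OF assms] by auto
  with * show "(a i \<omega>)\<^sup>2 < 1" "0 \<le> a i \<omega> ^ p" "a i \<omega> ^ p \<le> 1" "\<bar>a i \<omega> ^ p\<bar> \<le> 1"
    "(a0 \<omega>)\<^sup>2 < 1" "0 \<le> a0 \<omega> ^ p" "a0 \<omega> ^ p \<le> 1" "\<bar>a0 \<omega> ^ p\<bar> \<le> 1"
    by blast+
qed

lemma integrable_weight: "integrable M (\<lambda>\<omega>. a0 \<omega> ^ p / (1 - (a0 \<omega>)\<^sup>2)\<^sup>2)"
proof -
  have "integrable M (\<lambda>\<omega>. a0 \<omega> ^ p * (1 / (1 - (a0 \<omega>)\<^sup>2)\<^sup>2))"
    by (rule integrable_mult_bounded[OF coefficient_moment _ coefficient_bounds(12)]) auto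
  then show ?thesis by simp
qed

lemma integrable_weight_coefficient: "integrable M (\<lambda>\<omega>. a i \<omega> ^ p / (1 - (a i \<omega>)\<^sup>2)\<^sup>2)"
  and expectation_weight_coefficient: "expectation (\<lambda>\<omega>. a i \<omega> ^ p / (1 - (a i \<omega>)\<^sup>2)\<^sup>2) = weight_moment p"
proof -
  have g: "(\<lambda>x::real. x ^ p / (1 - x\<^sup>2)\<^sup>2) \<in> borel_measurable borel" by measurable
  show "integrable M (\<lambda>\<omega>. a i \<omega> ^ p / (1 - (a i \<omega>)\<^sup>2)\<^sup>2)"
    using integrable_coefficient[OF g, of i] integrable_weight by simp
  show "expectation (\<lambda>\<omega>. a i \<omega> ^ p / (1 - (a i \<omega>)\<^sup>2)\<^sup>2) = weight_moment p"
    using expectation_coefficient[OF g, of i] by (simp add: weight_moment_def)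
qed

lemma weight_moment_nonneg: "0 \<le> weight_moment p"
  unfolding weight_moment_def by (rule Bochner_Integration.integral_nonneg) (simp add: coefficient_bounds)

text \<open>Powers of \<open>a0 < 1\<close> vanish pointwise, and the case \<open>p = 0\<close> is
  an integrable dominating function.\<close>

lemma weight_moment_tendsto_0: "weight_moment \<longlonglongrightarrow> 0"
proof -
  have "(\<lambda>p. expectation (\<lambda>\<omega>. a0 \<omega> ^ p / (1 - (a0 \<omega>)\<^sup>2)\<^sup>2)) \<longlonglongrightarrow> expectation (\<lambda>\<omega>. 0)"
  proof (rule integral_dominated_convergence[where w = "\<lambda>\<omega>. 1 / (1 - (a0 \<omega>)\<^sup>2)\<^sup>2"])
    show "AE \<omega> in M. (\<lambda>p. a0 \<omega> ^ p / (1 - (a0 \<omega>)\<^sup>2)\<^sup>2) \<longlonglongrightarrow> 0"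
    proof (rule AE_I2)
      fix \<omega> assume "\<omega> \<in> space M"
      then have "(\<lambda>p. a0 \<omega> ^ p) \<longlonglongrightarrow> 0" by (intro LIMSEQ_power_zero) (auto simp: coefficient_bounds)
      from tendsto_divide_zero[OF this] show "(\<lambda>p. a0 \<omega> ^ p / (1 - (a0 \<omega>)\<^sup>2)\<^sup>2) \<longlonglongrightarrow> 0" .
    qed
    show "AE \<omega> in M. norm (a0 \<omega> ^ p / (1 - (a0 \<omega>)\<^sup>2)\<^sup>2) \<le> 1 / (1 - (a0 \<omega>)\<^sup>2)\<^sup>2" for p
      by (rule AE_I2) (auto simp: coefficient_bounds intro!: divide_right_mono)
  qed (use coefficient_moment in auto)
  then show ?thesis by (simp add: weight_moment_def[abs_def])
qed

lemma integrable_innovation_power: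
  assumes "j \<le> 4"
  shows "integrable M (\<lambda>\<omega>. \<epsilon> i u \<omega> ^ j)"
proof -
  have "integrable M (\<lambda>\<omega>. \<epsilon> i u \<omega> ^ 4)"
    using innovation_fourth_moment integrable_innovation[of "\<lambda>x. x ^ 4" i u] by simp
  from integrable_power_le_4[OF _ this assms] show ?thesis by simp
qed

lemma innovation_moments:
  "expectation (\<epsilon> i u) = 0" "expectation (\<lambda>\<omega>. (\<epsilon> i u \<omega>)\<^sup>2) = 1" "expectation (\<lambda>\<omega>. \<epsilon> i u \<omega> ^ 4) = m4"
proof -
  show "expectation (\<epsilon> i u) = 0"
    using expectation_innovation[of "\<lambda>x. x" i u] innovation_mean by simp
  show "expectation (\<lambda>\<omega>. (\<epsilon> i u \<omega>)\<^sup>2) = 1"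
    using expectation_innovation[of "\<lambda>x. x ^ 2" i u] innovation_variance innovation_mean by simp
  show "expectation (\<lambda>\<omega>. \<epsilon> i u \<omega> ^ 4) = m4"
    using expectation_innovation[of "\<lambda>x. x ^ 4" i u] by (simp add: m4_def)
qed

text \<open>The substitute for conditioning: \<open>Q\<close> may involve the coefficient and any
  innovations other than \<open>\<epsilon> i v\<close>, yet a power of the latter factors out of the
  expectation.\<close>

lemma expectation_mult_innovation:
  assumes Q: "Q \<in> borel_measurable (panel_sigma A)" "integrable M Q" and A: "Inr (i, v) \<notin> A"
    and j: "j \<le> 4"
  shows "integrable M (\<lambda>\<omega>. Q \<omega> * \<epsilon> i v \<omega> ^ j)"
    and "expectation (\<lambda>\<omega>. Q \<omega> * \<epsilon> i v \<omega> ^ j) = expectation Q * expectation (\<lambda>\<omega>. \<epsilon> i v \<omega> ^ j)"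
proof -
  have R: "(\<lambda>\<omega>. \<epsilon> i v \<omega> ^ j) \<in> borel_measurable (panel_sigma {Inr (i, v)})"
    using panel_sigma_innovation[of i v "{Inr (i, v)}"] by simp
  have "indep_var borel Q borel (\<lambda>\<omega>. \<epsilon> i v \<omega> ^ j)"
    by (rule indep_var_panel_sigma[OF _ Q(1) R]) (use A in auto)
  from indep_var_integrable[OF this Q(2) integrable_innovation_power[OF j]]
    indep_var_lebesgue_integral[OF this Q(2) integrable_innovation_power[OF j]]
  show "integrable M (\<lambda>\<omega>. Q \<omega> * \<epsilon> i v \<omega> ^ j)"
    "expectation (\<lambda>\<omega>. Q \<omega> * \<epsilon> i v \<omega> ^ j) = expectation Q * expectation (\<lambda>\<omega>. \<epsilon> i v \<omega> ^ j)" .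
qed

text \<open>Two bounds serve two purposes: \<open>L = 0\<close> gives the series truncated at lag
  \<open>K\<close>, and a positive \<open>L\<close> gives pieces of its tail.\<close>

definition partial_X :: "nat \<Rightarrow> nat \<Rightarrow> int \<Rightarrow> int \<Rightarrow> 'a \<Rightarrow> real" where
  "partial_X L K i u \<omega> = (\<Sum>k\<in>{L..<K}. a i \<omega> ^ k * \<epsilon> i (u - int k) \<omega>)"

definition past :: "nat \<Rightarrow> int \<Rightarrow> int \<Rightarrow> (int + int \<times> int) set" where
  "past K i u = insert (Inl i) ((\<lambda>k. Inr (i, u - int k)) ` {..<K})"

lemma partial_X_measurable [measurable]: "partial_X L K i u \<in> borel_measurable M"
  unfolding partial_X_def[abs_def] by measurable

lemma weighted_partial_X_past: "(\<lambda>\<omega>. a i \<omega> ^ p * partial_X L K i u \<omega> ^ j) \<in> borel_measurable (panel_sigma (past K i u))"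
proof -
  have [measurable]: "a i \<in> borel_measurable (panel_sigma (past K i u))"
    by (rule panel_sigma_coefficient) (simp add: past_def)
  have "\<epsilon> i (u - int k) \<in> borel_measurable (panel_sigma (past K i u))" if "k < K" for k
    by (rule panel_sigma_innovation) (use that in \<open>simp add: past_def\<close>)
  then have "(\<lambda>\<omega>. partial_X L K i u \<omega>) \<in> borel_measurable (panel_sigma (past K i u))"
    unfolding partial_X_def by (intro borel_measurable_sum borel_measurable_times) auto
  then show ?thesis by measurable
qed

lemma past_Suc: "Inr (i, u - int K) \<notin> past K i u"
  by (auto simp: past_def)

lemma partial_X_Suc:
  "partial_X L (Suc K) i u \<omega> = (if K < L then 0 else partial_X L K i u \<omega> + a i \<omega> ^ K * \<epsilon> i (u - int K) \<omega>)"
  by (simp add: partial_X_def)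

lemma integrable_partial_X_power4: "integrable M (\<lambda>\<omega>. partial_X L K i u \<omega> ^ 4)"
proof (induction K)
  case (Suc K)
  have "integrable M (\<lambda>\<omega>. a i \<omega> ^ (4 * K) * \<epsilon> i (u - int K) \<omega> ^ 4)"
    by (rule integrable_mult_bounded[OF integrable_innovation_power]) (auto simp: coefficient_bounds)
  then have "integrable M (\<lambda>\<omega>. (a i \<omega> ^ K * \<epsilon> i (u - int K) \<omega>) ^ 4)"
    by (simp add: power_mult_distrib power_mult[symmetric] mult.commute)
  from integrable_power4_add[OF _ _ Suc this] show ?case
    by (cases "K < L") (simp_all add: partial_X_Suc)
qed (simp add: partial_X_def)

lemma integrable_weighted_partial_X:
  assumes "j \<le> 4"
  shows "integrable M (\<lambda>\<omega>. a i \<omega> ^ p * partial_X L K i u \<omega> ^ j)"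
  by (rule integrable_mult_bounded[OF integrable_power_le_4[OF _ integrable_partial_X_power4 assms]])
     (auto simp: coefficient_bounds)

text \<open>Raising \<open>K\<close> by one appends the innovation at time \<open>u - K\<close>,
  which occurs neither in the coefficient nor in the earlier lags. Every moment recursion below
  expands a power of the longer sum into terms of this shape.\<close>

lemma weighted_step:
  assumes "j \<le> 4" "l \<le> 4"
  shows "integrable M (\<lambda>\<omega>. (a i \<omega> ^ p * partial_X L K i u \<omega> ^ j) * \<epsilon> i (u - int K) \<omega> ^ l)"
    and "expectation (\<lambda>\<omega>. (a i \<omega> ^ p * partial_X L K i u \<omega> ^ j) * \<epsilon> i (u - int K) \<omega> ^ l)
      = expectation (\<lambda>\<omega>. a i \<omega> ^ p * partial_X L K i u \<omega> ^ j) * expectation (\<lambda>\<omega>. \<epsilon> i (u - int K) \<omega> ^ l)"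
  by (rule expectation_mult_innovation[OF weighted_partial_X_past integrable_weighted_partial_X[OF assms(1)] past_Suc assms(2)])+

text \<open>Each appended innovation has mean zero. The weight is kept because the fourth moment
  recursion calls for it with exponent \<open>3 * K\<close>.\<close>

lemma expectation_weighted_partial_X:
  "expectation (\<lambda>\<omega>. a i \<omega> ^ p * partial_X L K i u \<omega>) = 0"
proof (induction K arbitrary: p)
  case (Suc K)
  show ?case
  proof (cases "K < L")
    case False
    let ?e = "\<epsilon> i (u - int K)"
    have "expectation (\<lambda>\<omega>. a i \<omega> ^ p * partial_X L (Suc K) i u \<omega>)
        = expectation (\<lambda>\<omega>. (a i \<omega> ^ p * partial_X L K i u \<omega>) + (a i \<omega> ^ (p + K) * partial_X L K i u \<omega> ^ 0) * ?e \<omega> ^ 1)"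
      using False by (simp add: partial_X_Suc algebra_simps power_add)
    also have "\<dots> = expectation (\<lambda>\<omega>. a i \<omega> ^ p * partial_X L K i u \<omega>)
        + expectation (\<lambda>\<omega>. (a i \<omega> ^ (p + K) * partial_X L K i u \<omega> ^ 0) * ?e \<omega> ^ 1)"
      by (rule Bochner_Integration.integral_add)
         (use integrable_weighted_partial_X[of 1] weighted_step(1)[of 0 1] in auto)
    also have "\<dots> = 0"
      by (subst weighted_step(2)) (simp_all add: Suc innovation_moments)
    finally show ?thesis .
  qed (simp add: partial_X_Suc)
qed (simp add: partial_X_def)

text \<open>The conditional variance of \<open>partial_X L K i u\<close> given the coefficient, as
  innovations have variance 1.\<close>

definition geo2 :: "nat \<Rightarrow> nat \<Rightarrow> int \<Rightarrow> 'a \<Rightarrow> real" where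
  "geo2 L K i \<omega> = (\<Sum>k\<in>{L..<K}. a i \<omega> ^ (2 * k))"

lemma geo2_measurable [measurable]: "geo2 L K i \<in> borel_measurable M"
  unfolding geo2_def[abs_def] by measurable

lemma geo2_Suc: "geo2 L (Suc K) i \<omega> = (if K < L then 0 else geo2 L K i \<omega> + a i \<omega> ^ (2 * K))"
  by (simp add: geo2_def)

lemma geo2_bounds:
  assumes "\<omega> \<in> space M"
  shows "0 \<le> geo2 L K i \<omega>" "geo2 L K i \<omega> \<le> real K" "(geo2 L K i \<omega>)\<^sup>2 \<le> a i \<omega> ^ (4 * L) / (1 - (a i \<omega>)\<^sup>2)\<^sup>2"
proof -
  show nn: "0 \<le> geo2 L K i \<omega>"
    unfolding geo2_def by (intro sum_nonneg) (simp add: coefficient_bounds assms)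
  have "geo2 L K i \<omega> \<le> (\<Sum>k\<in>{L..<K}. 1)"
    unfolding geo2_def by (intro sum_mono) (simp add: coefficient_bounds assms)
  then show "geo2 L K i \<omega> \<le> real K" by simp
  have "geo2 L K i \<omega> \<le> ((a i \<omega>)\<^sup>2) ^ L / (1 - (a i \<omega>)\<^sup>2)"
    unfolding geo2_def power_mult
    by (rule geometric_sum_le) (simp_all add: coefficient_bounds assms)
  then have "(geo2 L K i \<omega>)\<^sup>2 \<le> (((a i \<omega>)\<^sup>2) ^ L / (1 - (a i \<omega>)\<^sup>2))\<^sup>2"
    by (rule power_mono) (rule nn)
  also have "\<dots> = a i \<omega> ^ (4 * L) / (1 - (a i \<omega>)\<^sup>2)\<^sup>2"
    by (simp add: power_divide power_mult[symmetric] mult.commute)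
  finally show "(geo2 L K i \<omega>)\<^sup>2 \<le> a i \<omega> ^ (4 * L) / (1 - (a i \<omega>)\<^sup>2)\<^sup>2" .
qed

lemma integrable_geo2: "integrable M (\<lambda>\<omega>. a i \<omega> ^ p * geo2 L K i \<omega> ^ j)"
proof (rule integrable_mult_bounded)
  have "\<bar>geo2 L K i \<omega> ^ j\<bar> \<le> real K ^ j" if "\<omega> \<in> space M" for \<omega>
    using power_mono[OF geo2_bounds(2,1)[OF that]] geo2_bounds(1)[OF that] by simp
  then show "integrable M (\<lambda>\<omega>. geo2 L K i \<omega> ^ j)"
    by (intro integrable_const_bound[where B = "real K ^ j"] AE_I2) auto
qed (auto simp: coefficient_bounds)

text \<open>Says through power weights that \<open>geo2\<close> is the conditional second moment:
  the cross term vanishes because the new innovation is centred, and its square contributes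
  \<open>a i ^ (2 * K)\<close>. The weight \<open>2 * K\<close> is needed for the fourth
  moment.\<close>

lemma expectation_weighted_partial_X_power2:
  "expectation (\<lambda>\<omega>. a i \<omega> ^ p * (partial_X L K i u \<omega>)\<^sup>2) = expectation (\<lambda>\<omega>. a i \<omega> ^ p * geo2 L K i \<omega>)"
proof (induction K arbitrary: p)
  case (Suc K)
  show ?case
  proof (cases "K < L")
    case False
    let ?e = "\<epsilon> i (u - int K)" and ?S = "partial_X L K i u"
    have "expectation (\<lambda>\<omega>. a i \<omega> ^ p * (partial_X L (Suc K) i u \<omega>)\<^sup>2)
        = expectation (\<lambda>\<omega>. a i \<omega> ^ p * (?S \<omega>)\<^sup>2 + 2 * ((a i \<omega> ^ (p + K) * ?S \<omega> ^ 1) * ?e \<omega> ^ 1)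
            + (a i \<omega> ^ (p + 2 * K) * ?S \<omega> ^ 0) * ?e \<omega> ^ 2)"
    proof -
      \<comment> \<open>The redundant exponents 0 and 1 keep every term in the shape of
        \<open>weighted_step\<close>; for the same reason the simplifier is kept from removing them
        below.\<close>
      have "A * (S + B * e)\<^sup>2 = A * S\<^sup>2 + 2 * ((A * B * S ^ 1) * e ^ 1) + (A * B\<^sup>2 * S ^ 0) * e ^ 2" for A B S e :: real
        by (simp add: power2_sum power_mult_distrib distrib_left mult_ac)
      with False show ?thesis by (simp add: partial_X_Suc power_add power_even_eq)
    qed
    also have "\<dots> = expectation (\<lambda>\<omega>. a i \<omega> ^ p * (?S \<omega>)\<^sup>2)
        + 2 * expectation (\<lambda>\<omega>. (a i \<omega> ^ (p + K) * ?S \<omega> ^ 1) * ?e \<omega> ^ 1)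
        + expectation (\<lambda>\<omega>. (a i \<omega> ^ (p + 2 * K) * ?S \<omega> ^ 0) * ?e \<omega> ^ 2)"
      using weighted_step(1)[of 1 1] weighted_step(1)[of 0 2] integrable_weighted_partial_X[of 2]
      by (simp del: power_0 power_one_right)
    also have "expectation (\<lambda>\<omega>. (a i \<omega> ^ (p + K) * ?S \<omega> ^ 1) * ?e \<omega> ^ 1) = 0"
      by (subst weighted_step(2)) (simp_all add: innovation_moments)
    also have "expectation (\<lambda>\<omega>. (a i \<omega> ^ (p + 2 * K) * ?S \<omega> ^ 0) * ?e \<omega> ^ 2) = expectation (\<lambda>\<omega>. a i \<omega> ^ (p + 2 * K))"
      by (subst weighted_step(2)) (simp_all add: innovation_moments)
    also have "expectation (\<lambda>\<omega>. a i \<omega> ^ p * (?S \<omega>)\<^sup>2) = expectation (\<lambda>\<omega>. a i \<omega> ^ p * geo2 L K i \<omega>)"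
      by (rule Suc)
    also have "expectation (\<lambda>\<omega>. a i \<omega> ^ p * geo2 L K i \<omega>) + 2 * 0 + expectation (\<lambda>\<omega>. a i \<omega> ^ (p + 2 * K))
        = expectation (\<lambda>\<omega>. a i \<omega> ^ p * geo2 L (Suc K) i \<omega>)"
      using False integrable_geo2[of i p L K 1] integrable_geo2[of i "p + 2 * K" L K 0]
      by (simp add: geo2_Suc distrib_left power_add)
    finally show ?thesis .
  qed (simp add: partial_X_Suc geo2_Suc)
qed (simp add: partial_X_def geo2_def)

text \<open>Given the coefficient, the fourth moment is three times the squared variance plus
  \<open>m4 - 3\<close> times the sum of the \<open>a i ^ (4 * k)\<close>, which gives the constant
  \<open>3 + m4\<close>. The induction compares the increments of both sides as \<open>K\<close>
  grows.\<close>

lemma expectation_partial_X_power4_geo2: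
  "expectation (\<lambda>\<omega>. partial_X L K i u \<omega> ^ 4) \<le> (3 + m4) * expectation (\<lambda>\<omega>. (geo2 L K i \<omega>)\<^sup>2)"
proof (induction K)
  case (Suc K)
  show ?case
  proof (cases "K < L")
    case False
    let ?e = "\<epsilon> i (u - int K)" and ?S = "partial_X L K i u"
    let ?T = "\<lambda>p j l \<omega>. (a i \<omega> ^ p * ?S \<omega> ^ j) * ?e \<omega> ^ l"
    have int: "integrable M (?T p j l)" if "j \<le> 4" "l \<le> 4" for p j l
      using weighted_step(1)[OF that] .
    have "expectation (\<lambda>\<omega>. partial_X L (Suc K) i u \<omega> ^ 4)
        = expectation (\<lambda>\<omega>. ?T 0 4 0 \<omega> + 4 * ?T K 3 1 \<omega> + 6 * ?T (2 * K) 2 2 \<omega> + 4 * ?T (3 * K) 1 3 \<omega> + ?T (4 * K) 0 4 \<omega>)"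
      using False by (simp add: partial_X_Suc power4_sum_expand power_mult_distrib power_mult[symmetric] mult_ac)
    also have "\<dots> = expectation (?T 0 4 0) + 4 * expectation (?T K 3 1) + 6 * expectation (?T (2 * K) 2 2)
        + 4 * expectation (?T (3 * K) 1 3) + expectation (?T (4 * K) 0 4)"
    proof -
      note i = int[of 4 0 0] int[of 3 1 K] int[of 2 2 "2 * K"] int[of 1 3 "3 * K"] int[of 0 4 "4 * K"]
      show ?thesis
        using i by (simp del: power_0 power_one_right)
    qed
    also have "expectation (?T 0 4 0) = expectation (\<lambda>\<omega>. ?S \<omega> ^ 4)" by simp
    also have "expectation (?T K 3 1) = 0"
      by (subst weighted_step(2)) (simp_all add: innovation_moments)
    also have "expectation (?T (2 * K) 2 2) = expectation (\<lambda>\<omega>. a i \<omega> ^ (2 * K) * geo2 L K i \<omega>)"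
      by (subst weighted_step(2)) (simp_all add: innovation_moments expectation_weighted_partial_X_power2)
    \<comment> \<open>The third moment of the innovation may be nonzero; here it is the other
      factor, the weighted mean of the shorter sum, that vanishes.\<close>
    also have "expectation (?T (3 * K) 1 3) = 0"
      by (subst weighted_step(2)) (simp_all add: expectation_weighted_partial_X)
    also have "expectation (?T (4 * K) 0 4) = expectation (\<lambda>\<omega>. a i \<omega> ^ (4 * K)) * m4"
      by (subst weighted_step(2)) (simp_all add: innovation_moments)
    \<comment> \<open>The binomial coefficient 6 is absorbed by \<open>3 * 2\<close> and the fourth
      innovation moment by \<open>m4 * 1\<close>; the leftover terms on the right are
      nonnegative.\<close>
    also have "expectation (\<lambda>\<omega>. ?S \<omega> ^ 4) + 4 * 0 + 6 * expectation (\<lambda>\<omega>. a i \<omega> ^ (2 * K) * geo2 L K i \<omega>) + 4 * 0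
        + expectation (\<lambda>\<omega>. a i \<omega> ^ (4 * K)) * m4
        \<le> (3 + m4) * (expectation (\<lambda>\<omega>. (geo2 L K i \<omega>)\<^sup>2) + 2 * expectation (\<lambda>\<omega>. a i \<omega> ^ (2 * K) * geo2 L K i \<omega>)
            + expectation (\<lambda>\<omega>. a i \<omega> ^ (4 * K)))"
    proof -
      have "0 \<le> expectation (\<lambda>\<omega>. a i \<omega> ^ (2 * K) * geo2 L K i \<omega>)"
        by (rule Bochner_Integration.integral_nonneg) (simp add: coefficient_bounds geo2_bounds)
      moreover have "0 \<le> expectation (\<lambda>\<omega>. a i \<omega> ^ (4 * K))"
        by (rule Bochner_Integration.integral_nonneg) (simp add: coefficient_bounds)
      ultimately have "0 \<le> m4 * expectation (\<lambda>\<omega>. a i \<omega> ^ (2 * K) * geo2 L K i \<omega>)"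
        "0 \<le> expectation (\<lambda>\<omega>. a i \<omega> ^ (4 * K))"
        using m4_nonneg by auto
      with Suc show ?thesis by (simp add: algebra_simps)
    qed
    also have "expectation (\<lambda>\<omega>. (geo2 L K i \<omega>)\<^sup>2) + 2 * expectation (\<lambda>\<omega>. a i \<omega> ^ (2 * K) * geo2 L K i \<omega>)
            + expectation (\<lambda>\<omega>. a i \<omega> ^ (4 * K)) = expectation (\<lambda>\<omega>. (geo2 L K i \<omega>)\<^sup>2 + 2 * (a i \<omega> ^ (2 * K) * geo2 L K i \<omega>)
            + a i \<omega> ^ (4 * K))"
      using integrable_geo2[of i 0 L K 2] integrable_geo2[of i "2 * K" L K 1] integrable_geo2[of i "4 * K" L K 0]
      by simp
    also have "\<dots> = expectation (\<lambda>\<omega>. (geo2 L (Suc K) i \<omega>)\<^sup>2)"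
      using False by (simp add: geo2_Suc power2_sum power_mult[symmetric] ac_simps)
    finally show ?thesis .
  qed (simp add: partial_X_Suc geo2_Suc)
qed (simp add: partial_X_def geo2_def)

text \<open>Bounding \<open>geo2\<close> by the whole geometric tail removes the dependence on
  \<open>K\<close>, so the bound survives the passage to the infinite series.\<close>

lemma expectation_partial_X_power4:
  "expectation (\<lambda>\<omega>. partial_X L K i u \<omega> ^ 4) \<le> (3 + m4) * weight_moment (4 * L)"
proof -
  have "expectation (\<lambda>\<omega>. (geo2 L K i \<omega>)\<^sup>2) \<le> expectation (\<lambda>\<omega>. a i \<omega> ^ (4 * L) / (1 - (a i \<omega>)\<^sup>2)\<^sup>2)"
    using integrable_geo2[of i 0 L K 2] by (intro integral_mono integrable_weight_coefficient geo2_bounds) auto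
  then have "expectation (\<lambda>\<omega>. (geo2 L K i \<omega>)\<^sup>2) \<le> weight_moment (4 * L)" by (simp add: expectation_weight_coefficient)
  then have "(3 + m4) * expectation (\<lambda>\<omega>. (geo2 L K i \<omega>)\<^sup>2) \<le> (3 + m4) * weight_moment (4 * L)"
    by (rule mult_left_mono) (use m4_nonneg in simp)
  with expectation_partial_X_power4_geo2 show ?thesis by (rule order_trans)
qed

section \<open>The infinite series and its truncation error\<close>

text \<open>From \<open>1 - x ^ 2 = (1 - x) * (1 + x)\<close> with \<open>1 + x \<le> 2\<close>,
  followed by \<open>y \<le> 1 + y ^ 2\<close>. Needed for the almost sure summability of the
  series.\<close>

lemma integrable_inverse_one_minus_coefficient: "integrable M (\<lambda>\<omega>. 1 / (1 - a0 \<omega>))"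
proof (rule integrable_bounded_by[of _ "\<lambda>\<omega>. 2 * (1 + 1 / (1 - (a0 \<omega>)\<^sup>2)\<^sup>2)"])
  show "integrable M (\<lambda>\<omega>. 2 * (1 + 1 / (1 - (a0 \<omega>)\<^sup>2)\<^sup>2))"
    by (intro integrable_mult_right Bochner_Integration.integrable_add coefficient_moment) auto
  fix \<omega> assume \<omega>: "\<omega> \<in> space M"
  let ?x = "a0 \<omega>" let ?y = "1 / (1 - ?x\<^sup>2)"
  have x: "0 \<le> ?x" "?x < 1" "?x\<^sup>2 < 1" using coefficient_bounds[OF \<omega>] by auto
  have "1 - ?x\<^sup>2 = (1 - ?x) * (1 + ?x)" by (simp add: power2_eq_square algebra_simps)
  then have "1 / (1 - ?x) = (1 + ?x) * ?y" using x by simp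
  also have "\<dots> \<le> 2 * ?y" using x by (intro mult_right_mono) auto
  also have "\<dots> \<le> 2 * (1 + ?y\<^sup>2)"
  proof -
    have "2 * y \<le> 2 * (1 + y\<^sup>2)" for y :: real
      using sum_squares_bound[of 1 y] zero_le_power2[of y] unfolding distrib_left one_power2 mult_1_right by linarith
    then show ?thesis .
  qed
  finally show "\<bar>1 / (1 - ?x)\<bar> \<le> 2 * (1 + 1 / (1 - ?x\<^sup>2)\<^sup>2)"
    using x by (simp add: power_divide)
qed measurable

text \<open>By independence the absolute terms have total expectation
  \<open>E \<bar>\<epsilon>0\<bar> * E (1 / (1 - a0))\<close>, which is finite, so the series
  converges absolutely almost surely.\<close>

lemma AE_summable_panel_X: "AE \<omega> in M. summable (\<lambda>k. a i \<omega> ^ k * \<epsilon> i (u - int k) \<omega>)"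
proof -
  define c where "c = expectation (\<lambda>\<omega>. \<bar>\<epsilon>0 \<omega>\<bar>)"
  have c: "0 \<le> c" unfolding c_def by (rule Bochner_Integration.integral_nonneg) simp
  have termwise: "(\<integral>\<^sup>+\<omega>. ennreal (a i \<omega> ^ k * \<bar>\<epsilon> i (u - int k) \<omega>\<bar>) \<partial>M)
      = ennreal c * (\<integral>\<^sup>+\<omega>. ennreal (a0 \<omega> ^ k) \<partial>M)" for k
  proof -
    have A: "(\<lambda>\<omega>. a i \<omega> ^ k) \<in> borel_measurable (panel_sigma {Inl i})"
      using panel_sigma_coefficient[of i "{Inl i}"] by simp
    have E: "(\<lambda>\<omega>. \<bar>\<epsilon> i (u - int k) \<omega>\<bar>) \<in> borel_measurable (panel_sigma {Inr (i, u - int k)})"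
      using panel_sigma_innovation[of i "u - int k" "{Inr (i, u - int k)}"] by simp
    have ind: "indep_var borel (\<lambda>\<omega>. a i \<omega> ^ k) borel (\<lambda>\<omega>. \<bar>\<epsilon> i (u - int k) \<omega>\<bar>)"
      by (rule indep_var_panel_sigma[OF _ A E]) simp
    have iA: "integrable M (\<lambda>\<omega>. a i \<omega> ^ k)"
      by (rule integrable_const_bound[of _ 1]) (auto simp: coefficient_bounds)
    have iA0: "integrable M (\<lambda>\<omega>. a0 \<omega> ^ k)"
      by (rule integrable_const_bound[of _ 1]) (auto simp: coefficient_bounds)
    have iE: "integrable M (\<lambda>\<omega>. \<bar>\<epsilon> i (u - int k) \<omega>\<bar>)"
      using integrable_innovation_power[of 1] by simp
    have "(\<integral>\<^sup>+\<omega>. ennreal (a i \<omega> ^ k * \<bar>\<epsilon> i (u - int k) \<omega>\<bar>) \<partial>M)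
        = ennreal (expectation (\<lambda>\<omega>. a i \<omega> ^ k * \<bar>\<epsilon> i (u - int k) \<omega>\<bar>))"
      by (rule nn_integral_eq_integral[OF indep_var_integrable[OF ind iA iE]])
         (auto simp: coefficient_bounds)
    also have "expectation (\<lambda>\<omega>. a i \<omega> ^ k * \<bar>\<epsilon> i (u - int k) \<omega>\<bar>) = expectation (\<lambda>\<omega>. a0 \<omega> ^ k) * c"
      unfolding indep_var_lebesgue_integral[OF ind iA iE] c_def
      using expectation_coefficient[of "\<lambda>x. x ^ k" i] expectation_innovation[of abs i "u - int k"] by simp
    also have "ennreal (expectation (\<lambda>\<omega>. a0 \<omega> ^ k) * c) = ennreal (expectation (\<lambda>\<omega>. a0 \<omega> ^ k)) * ennreal c"
      using c by (intro ennreal_mult Bochner_Integration.integral_nonneg) (auto simp: coefficient_bounds)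
    also have "ennreal (expectation (\<lambda>\<omega>. a0 \<omega> ^ k)) = (\<integral>\<^sup>+\<omega>. ennreal (a0 \<omega> ^ k) \<partial>M)"
      by (rule nn_integral_eq_integral[OF iA0, symmetric]) (auto simp: coefficient_bounds)
    finally show ?thesis by (simp add: mult.commute)
  qed
  have "(\<integral>\<^sup>+\<omega>. (\<Sum>k. ennreal (a i \<omega> ^ k * \<bar>\<epsilon> i (u - int k) \<omega>\<bar>)) \<partial>M)
      = (\<Sum>k. ennreal c * (\<integral>\<^sup>+\<omega>. ennreal (a0 \<omega> ^ k) \<partial>M))"
    by (subst nn_integral_suminf) (auto simp: termwise)
  also have "\<dots> = ennreal c * (\<integral>\<^sup>+\<omega>. (\<Sum>k. ennreal (a0 \<omega> ^ k)) \<partial>M)"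
    by (subst nn_integral_suminf) auto
  also have "(\<integral>\<^sup>+\<omega>. (\<Sum>k. ennreal (a0 \<omega> ^ k)) \<partial>M) = (\<integral>\<^sup>+\<omega>. ennreal (1 / (1 - a0 \<omega>)) \<partial>M)"
  proof (rule nn_integral_cong)
    fix \<omega> assume \<omega>: "\<omega> \<in> space M"
    have "norm (a0 \<omega>) < 1" using coefficient_bounds[OF \<omega>] by simp
    then have "(\<lambda>k. a0 \<omega> ^ k) sums (1 / (1 - a0 \<omega>))" by (rule geometric_sums)
    then show "(\<Sum>k. ennreal (a0 \<omega> ^ k)) = ennreal (1 / (1 - a0 \<omega>))"
      using coefficient_bounds[OF \<omega>] by (intro suminf_ennreal_eq) auto
  qed
  also have "ennreal c * \<dots> < \<infinity>"
  proof -
    have "(\<integral>\<^sup>+\<omega>. ennreal (1 / (1 - a0 \<omega>)) \<partial>M) = ennreal (expectation (\<lambda>\<omega>. 1 / (1 - a0 \<omega>)))"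
      by (rule nn_integral_eq_integral[OF integrable_inverse_one_minus_coefficient])
         (auto simp: coefficient_bounds less_imp_le)
    then show ?thesis by (simp add: ennreal_mult_less_top)
  qed
  finally have "AE \<omega> in M. (\<Sum>k. ennreal (a i \<omega> ^ k * \<bar>\<epsilon> i (u - int k) \<omega>\<bar>)) \<noteq> \<infinity>"
    by (intro nn_integral_PInf_AE) auto
  then show ?thesis
  proof (rule AE_mp[OF _ AE_I2], intro impI)
    fix \<omega> assume \<omega>: "\<omega> \<in> space M" and fin: "(\<Sum>k. ennreal (a i \<omega> ^ k * \<bar>\<epsilon> i (u - int k) \<omega>\<bar>)) \<noteq> \<infinity>"
    have "summable (\<lambda>k. a i \<omega> ^ k * \<bar>\<epsilon> i (u - int k) \<omega>\<bar>)"
      by (rule summable_suminf_not_top) (use fin \<omega> in \<open>auto simp: coefficient_bounds\<close>)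
    moreover have "\<bar>a i \<omega> ^ k * \<epsilon> i (u - int k) \<omega>\<bar> = a i \<omega> ^ k * \<bar>\<epsilon> i (u - int k) \<omega>\<bar>" for k
      using coefficient_bounds(4)[OF \<omega>] by (simp only: abs_mult abs_of_nonneg)
    ultimately have "summable (\<lambda>k. \<bar>a i \<omega> ^ k * \<epsilon> i (u - int k) \<omega>\<bar>)"
      by (simp only:)
    then show "summable (\<lambda>k. a i \<omega> ^ k * \<epsilon> i (u - int k) \<omega>)"
      by (rule summable_rabs_cancel)
  qed
qed

abbreviation X :: "int \<Rightarrow> int \<Rightarrow> 'a \<Rightarrow> real" where "X \<equiv> panel_X \<epsilon> a"

lemma panel_X_measurable [measurable]: "X i u \<in> borel_measurable M"
  unfolding panel_X_def[abs_def] by measurable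

text \<open>The error is the almost sure limit of the tail pieces
  \<open>partial_X K (K + n)\<close>, whose fourth moments are bounded uniformly in
  \<open>n\<close>; Fatou's lemma does the rest. For \<open>K = 0\<close> this bounds the series
  itself.\<close>

lemma panel_X_minus_partial_X:
  shows "integrable M (\<lambda>\<omega>. (X i u \<omega> - partial_X 0 K i u \<omega>) ^ 4)"
    and "expectation (\<lambda>\<omega>. (X i u \<omega> - partial_X 0 K i u \<omega>) ^ 4) \<le> (3 + m4) * weight_moment (4 * K)"
proof -
  have "AE \<omega> in M. (\<lambda>n. partial_X K (K + n) i u \<omega> ^ 4) \<longlonglongrightarrow> (X i u \<omega> - partial_X 0 K i u \<omega>) ^ 4"
    using AE_summable_panel_X[of i u]
  proof eventually_elim
    case (elim \<omega>)
    let ?f = "\<lambda>k. a i \<omega> ^ k * \<epsilon> i (u - int k) \<omega>"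
    have "(\<lambda>n. \<Sum>k\<in>{0..<n}. ?f k) \<longlonglongrightarrow> X i u \<omega>"
      using summable_LIMSEQ[OF elim] by (simp add: panel_X_def atLeast0LessThan)
    from LIMSEQ_ignore_initial_segment[OF this, of K]
    have "(\<lambda>n. (\<Sum>k\<in>{0..<n + K}. ?f k) - (\<Sum>k\<in>{0..<K}. ?f k)) \<longlonglongrightarrow> X i u \<omega> - partial_X 0 K i u \<omega>"
      unfolding partial_X_def by (intro tendsto_diff tendsto_const)
    also have "(\<lambda>n. (\<Sum>k\<in>{0..<n + K}. ?f k) - (\<Sum>k\<in>{0..<K}. ?f k)) = (\<lambda>n. partial_X K (K + n) i u \<omega>)"
    proof
      fix n
      show "(\<Sum>k\<in>{0..<n + K}. ?f k) - (\<Sum>k\<in>{0..<K}. ?f k) = partial_X K (K + n) i u \<omega>"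
        using sum.atLeastLessThan_concat[of 0 K "K + n" ?f] by (simp add: partial_X_def add.commute)
    qed
    finally show ?case by (intro tendsto_power)
  qed
  note Fatou = integrable_Fatou[OF integrable_partial_X_power4 _ _ _ this expectation_partial_X_power4]
  show "integrable M (\<lambda>\<omega>. (X i u \<omega> - partial_X 0 K i u \<omega>) ^ 4)"
    by (rule Fatou) auto
  show "expectation (\<lambda>\<omega>. (X i u \<omega> - partial_X 0 K i u \<omega>) ^ 4) \<le> (3 + m4) * weight_moment (4 * K)"
    by (rule Fatou) auto
qed

lemma panel_X_power4: "integrable M (\<lambda>\<omega>. X i u \<omega> ^ 4)" "expectation (\<lambda>\<omega>. X i u \<omega> ^ 4) \<le> (3 + m4) * weight_moment 0"
  using panel_X_minus_partial_X[of i u 0] by (simp_all add: partial_X_def)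

text \<open>Write \<open>X * Y - P * Q = (X - P) * Y + (Y - Q) * P\<close>: each product has one
  small tail factor and one factor bounded in fourth moment. The bounds depend only on the common
  laws, so \<open>K0\<close> works for all \<open>i\<close> and \<open>u\<close>.\<close>

lemma truncation_error:
  fixes t :: int
  assumes \<delta>: "\<delta> > 0"
  shows "\<exists>K0. \<forall>K\<ge>K0. \<forall>i u.
    integrable M (\<lambda>\<omega>. (X i u \<omega> * X i (u + t) \<omega> - partial_X 0 K i u \<omega> * partial_X 0 K i (u + t) \<omega>)\<^sup>2) \<and>
    expectation (\<lambda>\<omega>. (X i u \<omega> * X i (u + t) \<omega> - partial_X 0 K i u \<omega> * partial_X 0 K i (u + t) \<omega>)\<^sup>2) \<le> \<delta>"
proof -
  define C where "C = 3 + m4"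
  have C: "C > 0" using m4_nonneg by (simp add: C_def)
  \<comment> \<open>Makes each of the two bounded contributions at most \<open>\<delta> / 4\<close>;
    adding 1 avoids division by zero. \<open>K0\<close> is then chosen in terms of
    \<open>l\<close>.\<close>
  define l where "l = \<delta> / (4 * (C * weight_moment 0 + 1))"
  have Cw: "0 \<le> C * weight_moment 0" using C weight_moment_nonneg by simp
  have l: "l > 0" using Cw \<delta> by (simp add: l_def)
  have "(\<lambda>K. weight_moment (4 * K)) \<longlonglongrightarrow> 0"
    using LIMSEQ_subseq_LIMSEQ[OF weight_moment_tendsto_0, of "\<lambda>K. 4 * K"] by (simp add: strict_mono_def o_def)
  then have "(\<lambda>K. 2 * (C * weight_moment (4 * K) / l)) \<longlonglongrightarrow> 2 * (C * 0 / l)"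
    using l by (intro tendsto_intros) auto
  then have "\<forall>\<^sub>F K in sequentially. 2 * (C * weight_moment (4 * K) / l) < \<delta> / 2"
    using \<delta> by (intro order_tendstoD(2)) auto
  then obtain K0 where K0: "\<And>K. K \<ge> K0 \<Longrightarrow> 2 * (C * weight_moment (4 * K) / l) < \<delta> / 2"
    unfolding eventually_sequentially by blast
  have "integrable M (\<lambda>\<omega>. (X i u \<omega> * X i (u + t) \<omega> - partial_X 0 K i u \<omega> * partial_X 0 K i (u + t) \<omega>)\<^sup>2) \<and>
    expectation (\<lambda>\<omega>. (X i u \<omega> * X i (u + t) \<omega> - partial_X 0 K i u \<omega> * partial_X 0 K i (u + t) \<omega>)\<^sup>2) \<le> \<delta>"
    if K: "K \<ge> K0" for K i u
  proof -
    let ?X = "X i u" and ?Y = "X i (u + t)" and ?P = "partial_X 0 K i u" and ?Q = "partial_X 0 K i (u + t)"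
    let ?B = "\<lambda>\<omega>. (?X \<omega> - ?P \<omega>) ^ 4 / l + l * ?Y \<omega> ^ 4 + ((?Y \<omega> - ?Q \<omega>) ^ 4 / l + l * ?P \<omega> ^ 4)"
    note ints = panel_X_minus_partial_X(1) panel_X_power4(1) integrable_partial_X_power4
    have pw: "(?X \<omega> * ?Y \<omega> - ?P \<omega> * ?Q \<omega>)\<^sup>2 \<le> ?B \<omega>" for \<omega>
    proof -
      have "(?X \<omega> * ?Y \<omega> - ?P \<omega> * ?Q \<omega>)\<^sup>2 = ((?X \<omega> - ?P \<omega>) * ?Y \<omega> + (?Y \<omega> - ?Q \<omega>) * ?P \<omega>)\<^sup>2"
        by (simp add: algebra_simps)
      also have "\<dots> \<le> 2 * ((?X \<omega> - ?P \<omega>) * ?Y \<omega>)\<^sup>2 + 2 * ((?Y \<omega> - ?Q \<omega>) * ?P \<omega>)\<^sup>2"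
        using sum_squares_bound[of "(?X \<omega> - ?P \<omega>) * ?Y \<omega>" "(?Y \<omega> - ?Q \<omega>) * ?P \<omega>"]
        by (simp only: power2_sum)
      also have "\<dots> \<le> ?B \<omega>"
        by (intro add_mono weighted_square_mult_le l)
      finally show ?thesis .
    qed
    have intB: "integrable M ?B" using ints by simp
    have int: "integrable M (\<lambda>\<omega>. (?X \<omega> * ?Y \<omega> - ?P \<omega> * ?Q \<omega>)\<^sup>2)"
      by (rule integrable_bounded_by[OF intB]) (use pw in auto)
    have "expectation (\<lambda>\<omega>. (?X \<omega> * ?Y \<omega> - ?P \<omega> * ?Q \<omega>)\<^sup>2) \<le> expectation ?B"
      by (rule integral_mono[OF int intB pw])
    also have "\<dots> = expectation (\<lambda>\<omega>. (?X \<omega> - ?P \<omega>) ^ 4) / l + l * expectation (\<lambda>\<omega>. ?Y \<omega> ^ 4)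
        + (expectation (\<lambda>\<omega>. (?Y \<omega> - ?Q \<omega>) ^ 4) / l + l * expectation (\<lambda>\<omega>. ?P \<omega> ^ 4))"
      using ints by simp
    also have "\<dots> \<le> C * weight_moment (4 * K) / l + l * (C * weight_moment 0) + (C * weight_moment (4 * K) / l + l * (C * weight_moment 0))"
      using l expectation_partial_X_power4[of 0 K i u]
      by (intro add_mono divide_right_mono mult_left_mono)
         (auto simp: C_def panel_X_minus_partial_X panel_X_power4)
    also have "\<dots> = 2 * (C * weight_moment (4 * K) / l) + 2 * (l * (C * weight_moment 0))" by simp
    also have "\<dots> \<le> \<delta> / 2 + \<delta> / 2"
    proof (rule add_mono)
      have "l * (C * weight_moment 0) \<le> l * (C * weight_moment 0 + 1)" using l by (intro mult_left_mono) auto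
      also have "\<dots> = \<delta> / 4" using Cw by (simp add: l_def field_simps)
      finally show "2 * (l * (C * weight_moment 0)) \<le> \<delta> / 2" by simp
    qed (use K0[OF K] in simp)
    finally show ?thesis using int by simp
  qed
  then show ?thesis by blast
qed

subsection \<open>Fluctuation of the lagged products within a unit\<close>

text \<open>A product of two innovations at distance \<open>s\<close>, minus its mean: 1 if they
  coincide, 0 otherwise.\<close>

definition noise :: "int \<Rightarrow> int \<Rightarrow> int \<Rightarrow> 'a \<Rightarrow> real" where
  "noise i s p \<omega> = \<epsilon> i p \<omega> * \<epsilon> i (p + s) \<omega> - (if s = 0 then 1 else 0)"

lemma noise_measurable [measurable]: "noise i s p \<in> borel_measurable M"
  unfolding noise_def[abs_def] by measurable

lemma noise_power2: "integrable M (\<lambda>\<omega>. (noise i s p \<omega>)\<^sup>2)" "expectation (\<lambda>\<omega>. (noise i s p \<omega>)\<^sup>2) \<le> 2 * m4 + 2"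
proof -
  let ?B = "\<lambda>\<omega>. \<epsilon> i p \<omega> ^ 4 + \<epsilon> i (p + s) \<omega> ^ 4 + 2"
  have pw: "(noise i s p \<omega>)\<^sup>2 \<le> ?B \<omega>" for \<omega>
  proof -
    \<comment> \<open>Parallelogram law with the square of \<open>x * y + c\<close> dropped.\<close>
    have gen: "(x * y - c)\<^sup>2 \<le> x ^ 4 + y ^ 4 + 2" if "c\<^sup>2 \<le> 1" for x y c :: real
    proof -
      have "(x * y - c)\<^sup>2 + (x * y + c)\<^sup>2 = 2 * (x * y)\<^sup>2 + 2 * c\<^sup>2" by (simp add: power2_eq_square algebra_simps)
      moreover have "2 * (x * y)\<^sup>2 \<le> x ^ 4 + y ^ 4" using weighted_square_mult_le[of 1 x y] by simp
      moreover have "0 \<le> (x * y + c)\<^sup>2" by simp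
      ultimately show ?thesis using that by linarith
    qed
    show ?thesis unfolding noise_def by (rule gen) simp
  qed
  have int4: "integrable M (\<lambda>\<omega>. \<epsilon> i p \<omega> ^ 4)" for p by (rule integrable_innovation_power) simp
  have intB: "integrable M ?B" using int4 by (intro Bochner_Integration.integrable_add) auto
  show int: "integrable M (\<lambda>\<omega>. (noise i s p \<omega>)\<^sup>2)"
    by (rule integrable_bounded_by[OF intB]) (use pw in auto)
  have "expectation (\<lambda>\<omega>. (noise i s p \<omega>)\<^sup>2) \<le> expectation ?B"
    by (rule integral_mono[OF int intB pw])
  also have "\<dots> = 2 * m4 + 2" using int4 by (simp add: innovation_moments prob_space)
  finally show "expectation (\<lambda>\<omega>. (noise i s p \<omega>)\<^sup>2) \<le> 2 * m4 + 2" .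
qed

lemma integrable_innovation_mult: "integrable M (\<lambda>\<omega>. \<epsilon> i p \<omega> * \<epsilon> i q \<omega>)"
proof (rule integrable_bounded_by[of _ "\<lambda>\<omega>. (\<epsilon> i p \<omega>)\<^sup>2 + (\<epsilon> i q \<omega>)\<^sup>2"])
  show "integrable M (\<lambda>\<omega>. (\<epsilon> i p \<omega>)\<^sup>2 + (\<epsilon> i q \<omega>)\<^sup>2)"
    by (intro Bochner_Integration.integrable_add integrable_innovation_power) simp_all
qed (measurable, rule abs_mult_le_power2_sum)

lemma integrable_innovation_mult3: "integrable M (\<lambda>\<omega>. \<epsilon> i p \<omega> * \<epsilon> i q \<omega> * \<epsilon> i r \<omega>)"
proof (rule integrable_bounded_by[of _ "\<lambda>\<omega>. (\<epsilon> i p \<omega> * \<epsilon> i q \<omega>)\<^sup>2 + (\<epsilon> i r \<omega>)\<^sup>2"])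
  show "integrable M (\<lambda>\<omega>. (\<epsilon> i p \<omega> * \<epsilon> i q \<omega>)\<^sup>2 + (\<epsilon> i r \<omega>)\<^sup>2)"
    by (intro Bochner_Integration.integrable_add integrable_power2_mult integrable_innovation_power
        measurable_panel) simp_all
qed (measurable, rule abs_mult_le_power2_sum)

text \<open>An innovation occurring only once factors out and has mean zero; the other three times
  may coincide.\<close>

lemma expectation_innovation_mult4_eq_0:
  assumes "v \<noteq> p" "v \<noteq> q" "v \<noteq> r"
  shows "expectation (\<lambda>\<omega>. \<epsilon> i p \<omega> * \<epsilon> i q \<omega> * \<epsilon> i r \<omega> * \<epsilon> i v \<omega>) = 0"
proof -
  let ?A = "{Inr (i, p), Inr (i, q), Inr (i, r)} :: (int + int \<times> int) set"
  have [measurable]: "\<epsilon> i p \<in> borel_measurable (panel_sigma ?A)" "\<epsilon> i q \<in> borel_measurable (panel_sigma ?A)"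
    "\<epsilon> i r \<in> borel_measurable (panel_sigma ?A)"
    by (rule panel_sigma_innovation; simp)+
  have "(\<lambda>\<omega>. \<epsilon> i p \<omega> * \<epsilon> i q \<omega> * \<epsilon> i r \<omega>) \<in> borel_measurable (panel_sigma ?A)"
    by measurable
  from expectation_mult_innovation(2)[OF this integrable_innovation_mult3, of i v 1] assms
  show ?thesis by (simp add: innovation_moments)
qed

text \<open>For \<open>s > 0\<close> the latest time \<open>p' + s\<close> occurs once among the
  four, for \<open>s < 0\<close> the earliest time \<open>p + s\<close> does. For
  \<open>s = 0\<close> the two factors involve different innovations and are independent and
  centred.\<close>

lemma expectation_noise_mult_less:
  assumes "p < p'"
  shows "expectation (\<lambda>\<omega>. noise i s p \<omega> * noise i s p' \<omega>) = 0"
proof -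
  consider "s > 0" | "s < 0" | "s = 0" by linarith
  then show ?thesis
  proof cases
    case 1
    have "expectation (\<lambda>\<omega>. noise i s p \<omega> * noise i s p' \<omega>)
        = expectation (\<lambda>\<omega>. \<epsilon> i p \<omega> * \<epsilon> i (p + s) \<omega> * \<epsilon> i p' \<omega> * \<epsilon> i (p' + s) \<omega>)"
      using 1 by (simp add: noise_def mult.assoc)
    also have "\<dots> = 0" by (rule expectation_innovation_mult4_eq_0) (use 1 assms in auto)
    finally show ?thesis .
  next
    case 2
    have "expectation (\<lambda>\<omega>. noise i s p \<omega> * noise i s p' \<omega>)
        = expectation (\<lambda>\<omega>. \<epsilon> i p \<omega> * \<epsilon> i p' \<omega> * \<epsilon> i (p' + s) \<omega> * \<epsilon> i (p + s) \<omega>)"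
      using 2 by (simp add: noise_def mult_ac)
    also have "\<dots> = 0" by (rule expectation_innovation_mult4_eq_0) (use 2 assms in auto)
    finally show ?thesis .
  next
    case 3
    have meas: "noise i 0 q \<in> borel_measurable (panel_sigma {Inr (i, q)})" for q
      using panel_sigma_innovation[of i q "{Inr (i, q)}"] unfolding noise_def[abs_def] by simp
    have int: "integrable M (noise i 0 q)" for q
      using integrable_innovation_mult[of i q q] unfolding noise_def[abs_def] by simp
    have "expectation (noise i 0 p') = 0"
      using integrable_innovation_mult[of i p' p'] innovation_moments(2)[of i p']
      unfolding noise_def[abs_def] by (simp add: power2_eq_square prob_space)
    with indep_var_lebesgue_integral[OF indep_var_panel_sigma[OF _ meas meas] int int, of p p'] assms 3
    show ?thesis by simp
  qed
qed

lemma expectation_noise_mult: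
  assumes "p \<noteq> p'"
  shows "expectation (\<lambda>\<omega>. noise i s p \<omega> * noise i s p' \<omega>) = 0"
  using assms expectation_noise_mult_less[of p p' i s] expectation_noise_mult_less[of p' p i s]
  by (cases p p' rule: linorder_cases) (simp_all add: mult.commute)

text \<open>Orthogonality makes the second moment linear in the number of terms; this is the source
  of the \<open>C * m\<close> part of the bound for one unit.\<close>

lemma noise_sum_power2:
  assumes U: "finite U"
  shows "integrable M (\<lambda>\<omega>. (\<Sum>u\<in>U. noise i s (u - j) \<omega>)\<^sup>2)"
    and "expectation (\<lambda>\<omega>. (\<Sum>u\<in>U. noise i s (u - j) \<omega>)\<^sup>2) \<le> real (card U) * (2 * m4 + 2)"
proof -
  show "integrable M (\<lambda>\<omega>. (\<Sum>u\<in>U. noise i s (u - j) \<omega>)\<^sup>2)"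
    by (rule integrable_power2_sum) (auto intro: noise_power2)
  have "expectation (\<lambda>\<omega>. (\<Sum>u\<in>U. noise i s (u - j) \<omega>)\<^sup>2) = (\<Sum>u\<in>U. expectation (\<lambda>\<omega>. (noise i s (u - j) \<omega>)\<^sup>2))"
    using U by (intro integral_power2_sum_orthogonal) (auto intro: noise_power2 expectation_noise_mult)
  also have "\<dots> \<le> (\<Sum>u\<in>U. 2 * m4 + 2)" by (intro sum_mono noise_power2)
  finally show "expectation (\<lambda>\<omega>. (\<Sum>u\<in>U. noise i s (u - j) \<omega>)\<^sup>2) \<le> real (card U) * (2 * m4 + 2)" by simp
qed

text \<open>The conditional mean of \<open>X i u * X i (u + t)\<close> given the coefficient, followed by that of the
  product of the truncated series.\<close>

definition lag_weight :: "int \<Rightarrow> int \<Rightarrow> 'a \<Rightarrow> real" where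
  "lag_weight t i \<omega> = a i \<omega> ^ nat \<bar>t\<bar> / (1 - (a i \<omega>)\<^sup>2)"

definition partial_lag_weight :: "nat \<Rightarrow> int \<Rightarrow> int \<Rightarrow> 'a \<Rightarrow> real" where
  "partial_lag_weight K t i \<omega> = (\<Sum>j<K. \<Sum>k<K. if int k = int j + t then a i \<omega> ^ (j + k) else 0)"

lemma lag_weight_measurable [measurable]: "lag_weight t i \<in> borel_measurable M"
  unfolding lag_weight_def[abs_def] by measurable

lemma partial_lag_weight_measurable [measurable]: "partial_lag_weight K t i \<in> borel_measurable M"
  unfolding partial_lag_weight_def[abs_def] by measurable

text \<open>The factor \<open>K ^ 4\<close> is \<open>K ^ 2\<close> from the Cauchy-Schwarz
  inequality over the pairs of lags \<open>(j, k)\<close>, times \<open>K ^ 2\<close> for their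
  number. Subtracting \<open>partial_lag_weight\<close> removes precisely the means of the
  coinciding pairs.\<close>

lemma truncated_products_power2:
  assumes U: "finite U"
  shows "integrable M (\<lambda>\<omega>. (\<Sum>u\<in>U. partial_X 0 K i u \<omega> * partial_X 0 K i (u + t) \<omega> - partial_lag_weight K t i \<omega>)\<^sup>2)"
    and "expectation (\<lambda>\<omega>. (\<Sum>u\<in>U. partial_X 0 K i u \<omega> * partial_X 0 K i (u + t) \<omega> - partial_lag_weight K t i \<omega>)\<^sup>2)
      \<le> real K ^ 4 * (2 * m4 + 2) * real (card U)"
proof -
  let ?I = "{..<K} \<times> {..<K}"
  let ?N = "\<lambda>jk \<omega>. \<Sum>u\<in>U. noise i (t + int (fst jk) - int (snd jk)) (u - int (fst jk)) \<omega>"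
  let ?f = "\<lambda>jk \<omega>. a i \<omega> ^ (fst jk + snd jk) * ?N jk \<omega>"
  have one: "partial_X 0 K i u \<omega> * partial_X 0 K i (u + t) \<omega> - partial_lag_weight K t i \<omega>
      = (\<Sum>jk\<in>?I. a i \<omega> ^ (fst jk + snd jk) * noise i (t + int (fst jk) - int (snd jk)) (u - int (fst jk)) \<omega>)" for u \<omega>
  proof -
    have "partial_X 0 K i u \<omega> * partial_X 0 K i (u + t) \<omega> - partial_lag_weight K t i \<omega>
      = (\<Sum>j<K. \<Sum>k<K. a i \<omega> ^ j * \<epsilon> i (u - int j) \<omega> * (a i \<omega> ^ k * \<epsilon> i (u + t - int k) \<omega>)
            - (if int k = int j + t then a i \<omega> ^ (j + k) else 0))"
      by (simp add: partial_X_def partial_lag_weight_def sum_product sum_subtractf atLeast0LessThan)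
    also have "\<dots> = (\<Sum>j<K. \<Sum>k<K. a i \<omega> ^ (j + k) * noise i (t + int j - int k) (u - int j) \<omega>)"
    proof (intro sum.cong refl)
      fix j k
      have e: "u - int j + (t + int j - int k) = u + t - int k" by simp
      have c: "int k = int j + t \<longleftrightarrow> t + int j - int k = 0" by auto
      show "a i \<omega> ^ j * \<epsilon> i (u - int j) \<omega> * (a i \<omega> ^ k * \<epsilon> i (u + t - int k) \<omega>)
            - (if int k = int j + t then a i \<omega> ^ (j + k) else 0)
          = a i \<omega> ^ (j + k) * noise i (t + int j - int k) (u - int j) \<omega>"
        unfolding noise_def e c by (simp add: right_diff_distrib power_add mult_ac)
    qed
    finally show ?thesis by (simp add: sum.cartesian_product split_def)
  qed
  have sum_eq: "(\<Sum>u\<in>U. partial_X 0 K i u \<omega> * partial_X 0 K i (u + t) \<omega> - partial_lag_weight K t i \<omega>)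
      = (\<Sum>jk\<in>?I. ?f jk \<omega>)" for \<omega>
    \<comment> \<open>The random weight \<open>a i ^ (j + k)\<close> is the same for all
      \<open>u\<close>, so it leaves the inner sum and can be bounded by 1 without
      conditioning.\<close>
    unfolding one by (subst sum.swap) (simp add: sum_distrib_left)
  have f: "integrable M (\<lambda>\<omega>. (?f jk \<omega>)\<^sup>2) \<and> expectation (\<lambda>\<omega>. (?f jk \<omega>)\<^sup>2) \<le> real (card U) * (2 * m4 + 2)" for jk
  proof -
    note N = noise_sum_power2[OF U, of i "t + int (fst jk) - int (snd jk)" "int (fst jk)"]
    have "integrable M (\<lambda>\<omega>. a i \<omega> ^ (2 * (fst jk + snd jk)) * (?N jk \<omega>)\<^sup>2)"
      by (rule integrable_mult_bounded[OF N(1)]) (auto simp: coefficient_bounds)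
    then have int: "integrable M (\<lambda>\<omega>. (?f jk \<omega>)\<^sup>2)"
      by (simp only: power_mult_distrib power_even_eq)
    have "expectation (\<lambda>\<omega>. (?f jk \<omega>)\<^sup>2) \<le> expectation (\<lambda>\<omega>. (?N jk \<omega>)\<^sup>2)"
    proof (rule integral_mono[OF int N(1)])
      fix \<omega> assume "\<omega> \<in> space M"
      then have "(a i \<omega> ^ (fst jk + snd jk))\<^sup>2 \<le> 1"
        using coefficient_bounds(6)[of \<omega>] by (simp only: abs_square_le_1)
      from mult_right_mono[OF this zero_le_power2[of "?N jk \<omega>"]]
      show "(?f jk \<omega>)\<^sup>2 \<le> (?N jk \<omega>)\<^sup>2" by (simp only: power_mult_distrib mult_1_left)
    qed
    with int N(2) show ?thesis by (blast intro: order_trans)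
  qed
  have fm: "?f jk \<in> borel_measurable M" for jk by measurable
  note S = integrable_power2_sum[of ?I ?f, OF fm conjunct1[OF f]]
  show "integrable M (\<lambda>\<omega>. (\<Sum>u\<in>U. partial_X 0 K i u \<omega> * partial_X 0 K i (u + t) \<omega> - partial_lag_weight K t i \<omega>)\<^sup>2)"
    unfolding sum_eq by (rule S(1))
  have "expectation (\<lambda>\<omega>. (\<Sum>jk\<in>?I. ?f jk \<omega>)\<^sup>2) \<le> real (card ?I) * (\<Sum>jk\<in>?I. expectation (\<lambda>\<omega>. (?f jk \<omega>)\<^sup>2))"
    by (rule S(2))
  also have "\<dots> \<le> real (card ?I) * (\<Sum>jk\<in>?I. real (card U) * (2 * m4 + 2))"
    by (intro mult_left_mono sum_mono conjunct2[OF f]) simp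
  also have "\<dots> = real K ^ 4 * (2 * m4 + 2) * real (card U)"
    by (simp add: card_cartesian_product power4_eq_xxxx)
  finally show "expectation (\<lambda>\<omega>. (\<Sum>u\<in>U. partial_X 0 K i u \<omega> * partial_X 0 K i (u + t) \<omega> - partial_lag_weight K t i \<omega>)\<^sup>2)
      \<le> real K ^ 4 * (2 * m4 + 2) * real (card U)"
    unfolding sum_eq .
qed

text \<open>Only the pairs of lags that differ by \<open>\<bar>t\<bar>\<close> contribute, and
  \<open>K - \<bar>t\<bar>\<close> of them fit below \<open>K\<close>; a negative \<open>t\<close>
  exchanges the roles of \<open>j\<close> and \<open>k\<close>.\<close>

lemma partial_lag_weight_eq:
  "partial_lag_weight K t i \<omega> = (\<Sum>l<K - nat \<bar>t\<bar>. a i \<omega> ^ (nat \<bar>t\<bar> + 2 * l))"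
proof -
  have aux: "(\<Sum>j<K. \<Sum>k<K. if k = j + T then x ^ (j + k) else 0) = (\<Sum>l<K - T. x ^ (T + 2 * l))" for T and x :: real
  proof -
    have "(\<Sum>j<K. \<Sum>k<K. if k = j + T then x ^ (j + k) else 0) = (\<Sum>j<K. if j + T < K then x ^ (j + (j + T)) else 0)"
      by (intro sum.cong refl) simp
    also have "\<dots> = (\<Sum>j\<in>{j. j < K \<and> j + T < K}. x ^ (j + (j + T)))"
      by (simp add: sum.inter_filter[symmetric])
    also have "{j. j < K \<and> j + T < K} = {..<K - T}" by auto
    also have "(\<Sum>j<K - T. x ^ (j + (j + T))) = (\<Sum>l<K - T. x ^ (T + 2 * l))"
      by (intro sum.cong refl arg_cong[where f = "power x"]) simp
    finally show ?thesis .
  qed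
  show ?thesis
  proof (cases "t \<ge> 0")
    case True
    then have "int k = int j + t \<longleftrightarrow> k = j + nat \<bar>t\<bar>" for j k by auto
    then show ?thesis unfolding partial_lag_weight_def by (simp only: aux)
  next
    case False
    then have *: "int k = int j + t \<longleftrightarrow> j = k + nat \<bar>t\<bar>" for j k by auto
    have "partial_lag_weight K t i \<omega> = (\<Sum>k<K. \<Sum>j<K. if j = k + nat \<bar>t\<bar> then a i \<omega> ^ (k + j) else 0)"
      unfolding partial_lag_weight_def * by (subst sum.swap) (simp only: add.commute)
    then show ?thesis by (simp only: aux)
  qed
qed

text \<open>The remainder of the geometric series in \<open>a ^ 2\<close> after
  \<open>K - \<bar>t\<bar>\<close> terms; the exponent is
  \<open>\<bar>t\<bar> + 2 * (K - \<bar>t\<bar>)\<close>.\<close>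

lemma lag_weight_minus_partial:
  assumes \<omega>: "\<omega> \<in> space M" and K: "nat \<bar>t\<bar> \<le> K"
  shows "lag_weight t i \<omega> - partial_lag_weight K t i \<omega> = a i \<omega> ^ (2 * K - nat \<bar>t\<bar>) / (1 - (a i \<omega>)\<^sup>2)"
proof -
  let ?T = "nat \<bar>t\<bar>" and ?x = "(a i \<omega>)\<^sup>2"
  have x: "?x < 1" using coefficient_bounds[OF \<omega>] by simp
  have "partial_lag_weight K t i \<omega> = a i \<omega> ^ ?T * (\<Sum>l<K - ?T. ?x ^ l)"
    by (simp add: partial_lag_weight_eq power_add power_mult sum_distrib_left)
  also have "(\<Sum>l<K - ?T. ?x ^ l) = (1 - ?x ^ (K - ?T)) / (1 - ?x)"
    using x by (simp add: sum_gp_strict)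
  finally have "lag_weight t i \<omega> - partial_lag_weight K t i \<omega> = a i \<omega> ^ ?T * ?x ^ (K - ?T) / (1 - ?x)"
    using x by (simp add: lag_weight_def diff_divide_distrib[symmetric] right_diff_distrib)
  also have "a i \<omega> ^ ?T * ?x ^ (K - ?T) = a i \<omega> ^ (2 * K - ?T)"
  proof -
    have "m + 2 * (K - m) = 2 * K - m" if "m \<le> K" for m using that by simp
    from this[OF K] show ?thesis by (simp only: power_mult[symmetric] power_add[symmetric])
  qed
  finally show ?thesis .
qed

text \<open>Squaring gives the exponent \<open>2 * (2 * K - \<bar>t\<bar>)\<close>, which is at
  least \<open>K\<close>; the crude exponent suffices for convergence to 0.\<close>

lemma lag_weight_minus_partial_power2:
  assumes K: "nat \<bar>t\<bar> \<le> K"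
  shows "integrable M (\<lambda>\<omega>. (lag_weight t i \<omega> - partial_lag_weight K t i \<omega>)\<^sup>2)"
    and "expectation (\<lambda>\<omega>. (lag_weight t i \<omega> - partial_lag_weight K t i \<omega>)\<^sup>2) \<le> weight_moment K"
proof -
  have pw: "(lag_weight t i \<omega> - partial_lag_weight K t i \<omega>)\<^sup>2 \<le> a i \<omega> ^ K / (1 - (a i \<omega>)\<^sup>2)\<^sup>2"
    if \<omega>: "\<omega> \<in> space M" for \<omega>
  proof -
    have "(lag_weight t i \<omega> - partial_lag_weight K t i \<omega>)\<^sup>2 = a i \<omega> ^ (2 * (2 * K - nat \<bar>t\<bar>)) / (1 - (a i \<omega>)\<^sup>2)\<^sup>2"
      unfolding lag_weight_minus_partial[OF \<omega> K] power_divide power_mult[symmetric] by (simp add: mult.commute)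
    also have "\<dots> \<le> a i \<omega> ^ K / (1 - (a i \<omega>)\<^sup>2)\<^sup>2"
    proof (intro divide_right_mono power_decreasing)
      have "K \<le> 2 * (2 * K - m)" if "m \<le> K" for m using that by simp
      from this[OF K] show "K \<le> 2 * (2 * K - nat \<bar>t\<bar>)" .
    qed (use coefficient_bounds(1,2)[OF \<omega>, of i] in auto)
    finally show ?thesis .
  qed
  show int: "integrable M (\<lambda>\<omega>. (lag_weight t i \<omega> - partial_lag_weight K t i \<omega>)\<^sup>2)"
    by (rule integrable_bounded_by[OF integrable_weight_coefficient[of i K]]) (use pw in auto)
  from integral_mono[OF int integrable_weight_coefficient pw]
  show "expectation (\<lambda>\<omega>. (lag_weight t i \<omega> - partial_lag_weight K t i \<omega>)\<^sup>2) \<le> weight_moment K"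
    by (simp add: expectation_weight_coefficient)
qed

text \<open>The quadratic term comes from replacing series and conditional mean by their
  truncations, where no orthogonality is used and smallness comes from \<open>K\<close>. The linear
  term comes from the truncated products; its constant depends on \<open>K\<close>, hence on
  \<open>\<delta>\<close>, but not on \<open>i\<close> or \<open>U\<close>.\<close>

lemma lagged_products_L2:
  assumes \<delta>: "\<delta> > 0"
  shows "\<exists>C\<ge>0. \<forall>i U. finite U \<longrightarrow>
    integrable M (\<lambda>\<omega>. (\<Sum>u\<in>U. X i u \<omega> * X i (u + t) \<omega> - lag_weight t i \<omega>)\<^sup>2) \<and>
    expectation (\<lambda>\<omega>. (\<Sum>u\<in>U. X i u \<omega> * X i (u + t) \<omega> - lag_weight t i \<omega>)\<^sup>2)
      \<le> \<delta> * (real (card U))\<^sup>2 + C * real (card U)"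
proof -
  \<comment> \<open>Two errors of size \<open>\<delta> / 6\<close>, each multiplied by 3 in the
    inequality for the square of three summands, add up to \<open>\<delta>\<close>.\<close>
  have \<delta>6: "\<delta> / 6 > 0" using \<delta> by simp
  from truncation_error[OF this, of t] obtain K0 where K0: "\<And>K i u. K \<ge> K0 \<Longrightarrow>
    integrable M (\<lambda>\<omega>. (X i u \<omega> * X i (u + t) \<omega> - partial_X 0 K i u \<omega> * partial_X 0 K i (u + t) \<omega>)\<^sup>2) \<and>
    expectation (\<lambda>\<omega>. (X i u \<omega> * X i (u + t) \<omega> - partial_X 0 K i u \<omega> * partial_X 0 K i (u + t) \<omega>)\<^sup>2) \<le> \<delta> / 6"
    by blast
  have "\<forall>\<^sub>F K in sequentially. weight_moment K < \<delta> / 6"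
    by (rule order_tendstoD(2)[OF weight_moment_tendsto_0 \<delta>6])
  then obtain K1 where K1: "\<And>K. K \<ge> K1 \<Longrightarrow> weight_moment K < \<delta> / 6" unfolding eventually_sequentially by blast
  define K where "K = max (nat \<bar>t\<bar>) (max K0 K1)"
  have K: "nat \<bar>t\<bar> \<le> K" "K0 \<le> K" "K1 \<le> K" by (auto simp: K_def)
  define C where "C = 3 * (real K ^ 4 * (2 * m4 + 2))"
  have C: "C \<ge> 0" using m4_nonneg by (simp add: C_def)
  have "integrable M (\<lambda>\<omega>. (\<Sum>u\<in>U. X i u \<omega> * X i (u + t) \<omega> - lag_weight t i \<omega>)\<^sup>2) \<and>
    expectation (\<lambda>\<omega>. (\<Sum>u\<in>U. X i u \<omega> * X i (u + t) \<omega> - lag_weight t i \<omega>)\<^sup>2)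
      \<le> \<delta> * (real (card U))\<^sup>2 + C * real (card U)" if U: "finite U" for i U
  proof -
    let ?n = "real (card U)"
    define E where "E u \<omega> = X i u \<omega> * X i (u + t) \<omega> - partial_X 0 K i u \<omega> * partial_X 0 K i (u + t) \<omega>" for u \<omega>
    define G where "G u \<omega> = partial_X 0 K i u \<omega> * partial_X 0 K i (u + t) \<omega> - partial_lag_weight K t i \<omega>" for u \<omega>
    define H where "H \<omega> = lag_weight t i \<omega> - partial_lag_weight K t i \<omega>" for \<omega>
    have [measurable]: "E u \<in> borel_measurable M" "G u \<in> borel_measurable M" "H \<in> borel_measurable M" for u
      unfolding E_def[abs_def] G_def[abs_def] H_def[abs_def] by measurable
    have E: "integrable M (\<lambda>\<omega>. (E u \<omega>)\<^sup>2)" "expectation (\<lambda>\<omega>. (E u \<omega>)\<^sup>2) \<le> \<delta> / 6" for u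
      using K0[OF K(2), of i u] by (simp_all add: E_def)
    have ES: "integrable M (\<lambda>\<omega>. (\<Sum>u\<in>U. E u \<omega>)\<^sup>2)"
      "expectation (\<lambda>\<omega>. (\<Sum>u\<in>U. E u \<omega>)\<^sup>2) \<le> ?n * (\<Sum>u\<in>U. expectation (\<lambda>\<omega>. (E u \<omega>)\<^sup>2))"
      by (rule integrable_power2_sum; simp add: E(1))+
    have "?n * (\<Sum>u\<in>U. expectation (\<lambda>\<omega>. (E u \<omega>)\<^sup>2)) \<le> ?n * (\<Sum>u\<in>U. \<delta> / 6)"
      by (intro mult_left_mono sum_mono E) simp
    with ES(2) have ES2: "expectation (\<lambda>\<omega>. (\<Sum>u\<in>U. E u \<omega>)\<^sup>2) \<le> ?n\<^sup>2 * (\<delta> / 6)"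
      by (simp add: power2_eq_square)
    have GS: "integrable M (\<lambda>\<omega>. (\<Sum>u\<in>U. G u \<omega>)\<^sup>2)"
      "3 * expectation (\<lambda>\<omega>. (\<Sum>u\<in>U. G u \<omega>)\<^sup>2) \<le> C * ?n"
      using truncated_products_power2[OF U, of K i t] by (simp_all add: G_def C_def)
    have HS: "integrable M (\<lambda>\<omega>. (H \<omega>)\<^sup>2)" "expectation (\<lambda>\<omega>. (H \<omega>)\<^sup>2) \<le> \<delta> / 6"
      using lag_weight_minus_partial_power2[OF K(1), of i] K1[OF K(3)] by (auto simp: H_def)
    let ?B = "\<lambda>\<omega>. 3 * (\<Sum>u\<in>U. E u \<omega>)\<^sup>2 + 3 * (\<Sum>u\<in>U. G u \<omega>)\<^sup>2 + 3 * (?n\<^sup>2 * (H \<omega>)\<^sup>2)"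
    have pw: "(\<Sum>u\<in>U. X i u \<omega> * X i (u + t) \<omega> - lag_weight t i \<omega>)\<^sup>2 \<le> ?B \<omega>" for \<omega>
    proof -
      have "(\<Sum>u\<in>U. X i u \<omega> * X i (u + t) \<omega> - lag_weight t i \<omega>) = (\<Sum>u\<in>U. E u \<omega> + G u \<omega> + - H \<omega>)"
        by (intro sum.cong) (simp_all add: E_def G_def H_def)
      also have "\<dots> = (\<Sum>u\<in>U. E u \<omega>) + (\<Sum>u\<in>U. G u \<omega>) + ?n * - H \<omega>"
        by (simp add: sum.distrib sum_subtractf)
      finally show ?thesis
        using power2_sum3_le[of "\<Sum>u\<in>U. E u \<omega>" "\<Sum>u\<in>U. G u \<omega>" "?n * - H \<omega>"]
        by (simp add: power_mult_distrib)
    qed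
    have intB: "integrable M ?B" using ES(1) GS(1) HS(1) by simp
    have int: "integrable M (\<lambda>\<omega>. (\<Sum>u\<in>U. X i u \<omega> * X i (u + t) \<omega> - lag_weight t i \<omega>)\<^sup>2)"
      by (rule integrable_bounded_by[OF intB]) (use pw in auto)
    have "expectation (\<lambda>\<omega>. (\<Sum>u\<in>U. X i u \<omega> * X i (u + t) \<omega> - lag_weight t i \<omega>)\<^sup>2) \<le> expectation ?B"
      by (rule integral_mono[OF int intB pw])
    also have "\<dots> = 3 * expectation (\<lambda>\<omega>. (\<Sum>u\<in>U. E u \<omega>)\<^sup>2) + 3 * expectation (\<lambda>\<omega>. (\<Sum>u\<in>U. G u \<omega>)\<^sup>2)
        + 3 * (?n\<^sup>2 * expectation (\<lambda>\<omega>. (H \<omega>)\<^sup>2))"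
      using ES(1) GS(1) HS(1) by simp
    also have "\<dots> \<le> 3 * (?n\<^sup>2 * (\<delta> / 6)) + C * ?n + 3 * (?n\<^sup>2 * (\<delta> / 6))"
      by (intro add_mono mult_left_mono ES2 GS(2) HS(2)) auto
    also have "\<dots> = \<delta> * ?n\<^sup>2 + C * ?n" by simp
    finally show ?thesis using int by simp
  qed
  with C show ?thesis by blast
qed

subsection \<open>Central limit theorem over the units\<close>

text \<open>All variables of unit \<open>i\<close>, as the full series involves infinitely many
  innovations; these index sets are disjoint for different units.\<close>

definition unit_index :: "int \<Rightarrow> (int + int \<times> int) set" where
  "unit_index i = insert (Inl i) (range (\<lambda>u. Inr (i, u)))"

definition centred_products :: "int \<Rightarrow> int set \<Rightarrow> int \<Rightarrow> 'a \<Rightarrow> real" where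
  "centred_products t U i \<omega> = (\<Sum>u\<in>U. X i u \<omega> * X i (u + t) \<omega> - lag_weight t i \<omega>)"

lemma centred_products_measurable [measurable]: "centred_products t U i \<in> borel_measurable M"
  unfolding centred_products_def[abs_def] by measurable

lemma centred_products_unit: "centred_products t U i \<in> borel_measurable (panel_sigma (unit_index i))"
proof -
  have [measurable]: "a i \<in> borel_measurable (panel_sigma (unit_index i))"
    "\<epsilon> i u \<in> borel_measurable (panel_sigma (unit_index i))" for u
    by (auto intro!: panel_sigma_coefficient panel_sigma_innovation simp: unit_index_def)
  show ?thesis
    unfolding centred_products_def[abs_def] panel_X_def lag_weight_def by measurable
qed

text \<open>Independence of the units makes variances add, so the bound grows like the number of
  units and not like its square. Subtracting the expectation makes the mixed terms vanish and does
  not increase the second moment.\<close>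

lemma expectation_square_sum_centred_le:
  assumes I: "finite I" and U: "finite U"
    and int: "\<And>i. integrable M (\<lambda>\<omega>. (centred_products t U i \<omega>)\<^sup>2)"
    and bound: "\<And>i. expectation (\<lambda>\<omega>. (centred_products t U i \<omega>)\<^sup>2) \<le> b"
  shows "integrable M (\<lambda>\<omega>. (\<Sum>i\<in>I. centred_products t U i \<omega> - expectation (centred_products t U i))\<^sup>2)"
    and "expectation (\<lambda>\<omega>. (\<Sum>i\<in>I. centred_products t U i \<omega> - expectation (centred_products t U i))\<^sup>2)
      \<le> real (card I) * b"
proof -
  let ?T = "centred_products t U"
  have int1: "integrable M (?T i)" for i
    by (rule square_integrable_imp_integrable[OF _ int]) measurable
  have int2: "integrable M (\<lambda>\<omega>. (?T i \<omega> - expectation (?T i))\<^sup>2)" for i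
    using int1[of i] int[of i] by (simp add: power2_diff)
  have le: "expectation (\<lambda>\<omega>. (?T i \<omega> - expectation (?T i))\<^sup>2) \<le> b" for i
    using bound[of i] variance_eq[OF int1 int, of i] zero_le_power2[of "expectation (?T i)"] by linarith
  have orth: "expectation (\<lambda>\<omega>. (?T i \<omega> - expectation (?T i)) * (?T j \<omega> - expectation (?T j))) = 0"
    if "i \<noteq> j" for i j
  proof -
    have m: "(\<lambda>\<omega>. ?T i \<omega> - expectation (?T i)) \<in> borel_measurable (panel_sigma (unit_index i))" for i
      using centred_products_unit by (rule borel_measurable_diff) simp
    have "indep_var borel (\<lambda>\<omega>. ?T i \<omega> - expectation (?T i)) borel (\<lambda>\<omega>. ?T j \<omega> - expectation (?T j))"
      by (rule indep_var_panel_sigma[OF _ m m]) (use that in \<open>auto simp: unit_index_def\<close>)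
    from indep_var_lebesgue_integral[OF this] int1 show ?thesis
      by (simp add: prob_space)
  qed
  show "integrable M (\<lambda>\<omega>. (\<Sum>i\<in>I. ?T i \<omega> - expectation (?T i))\<^sup>2)"
    by (rule integrable_power2_sum) (use int2 in auto)
  have "expectation (\<lambda>\<omega>. (\<Sum>i\<in>I. ?T i \<omega> - expectation (?T i))\<^sup>2)
      = (\<Sum>i\<in>I. expectation (\<lambda>\<omega>. (?T i \<omega> - expectation (?T i))\<^sup>2))"
    by (rule integral_power2_sum_orthogonal[OF I _ int2 orth]) measurable
  also have "\<dots> \<le> (\<Sum>i\<in>I. b)" by (intro sum_mono le)
  finally show "expectation (\<lambda>\<omega>. (\<Sum>i\<in>I. ?T i \<omega> - expectation (?T i))\<^sup>2) \<le> real (card I) * b" by simp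
qed

section \<open>Moments and limit law of the lag weights\<close>

definition lag_mean :: "int \<Rightarrow> real" where
  "lag_mean t = expectation (\<lambda>\<omega>. a0 \<omega> ^ nat \<bar>t\<bar> / (1 - (a0 \<omega>)\<^sup>2))"

definition lag_var :: "int \<Rightarrow> real" where
  "lag_var t = variance (\<lambda>\<omega>. a0 \<omega> ^ nat \<bar>t\<bar> / (1 - (a0 \<omega>)\<^sup>2))"

definition lag_clt_sum :: "int \<Rightarrow> nat \<Rightarrow> 'a \<Rightarrow> real" where
  "lag_clt_sum t N \<omega> = (\<Sum>i\<in>{1..int N}. lag_weight t i \<omega> - lag_mean t) / sqrt (real N)"

lemma lag_clt_sum_measurable [measurable]: "lag_clt_sum t N \<in> borel_measurable M"
  unfolding lag_clt_sum_def[abs_def] by measurable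

lemma lag_var_nonneg: "0 \<le> lag_var t"
  unfolding lag_var_def by (rule Bochner_Integration.integral_nonneg) simp

lemma lag_weight_moments:
  "integrable M (\<lambda>\<omega>. (lag_weight t i \<omega>)\<^sup>2)" "integrable M (lag_weight t i)"
  "expectation (lag_weight t i) = lag_mean t" "variance (lag_weight t i) = lag_var t"
proof -
  have "integrable M (\<lambda>\<omega>. a i \<omega> ^ (nat \<bar>t\<bar> * 2) / (1 - (a i \<omega>)\<^sup>2)\<^sup>2)"
    by (rule integrable_weight_coefficient)
  then show int2: "integrable M (\<lambda>\<omega>. (lag_weight t i \<omega>)\<^sup>2)"
    by (simp only: lag_weight_def power_divide power_mult)
  show "integrable M (lag_weight t i)"
    by (rule square_integrable_imp_integrable[OF _ int2]) measurable
  have g: "(\<lambda>x::real. x ^ nat \<bar>t\<bar> / (1 - x\<^sup>2)) \<in> borel_measurable borel" by measurable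
  show mean: "expectation (lag_weight t i) = lag_mean t"
    using expectation_coefficient[OF g, of i] by (simp add: lag_weight_def[abs_def] lag_mean_def)
  have g2: "(\<lambda>x::real. (x ^ nat \<bar>t\<bar> / (1 - x\<^sup>2) - lag_mean t)\<^sup>2) \<in> borel_measurable borel" by measurable
  show "variance (lag_weight t i) = lag_var t"
    using expectation_coefficient[OF g2, of i] unfolding mean
    by (simp add: lag_weight_def[abs_def] lag_var_def lag_mean_def)
qed

text \<open>Shifted to a sequence starting at 0, as the central limit theorem expects, while units
  are numbered from 1.\<close>

lemma indep_lag_weight: "indep_vars (\<lambda>_. borel) (\<lambda>n. lag_weight t (int n + 1)) UNIV"
proof -
  let ?K = "\<lambda>n::nat. {Inl (int n + 1)} :: (int + int \<times> int) set"
  let ?g = "\<lambda>n f. f (Inl (int n + 1)) ^ nat \<bar>t\<bar> / (1 - (f (Inl (int n + 1)))\<^sup>2) :: real"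
  have "indep_vars (\<lambda>_. borel) panel_family (UNIV :: (int + int \<times> int) set)"
    using independent unfolding panel_family_def .
  then have "indep_vars (\<lambda>n. PiM (?K n) (\<lambda>_. borel)) (\<lambda>n \<omega>. restrict (\<lambda>k. panel_family k \<omega>) (?K n)) UNIV"
    by (rule indep_vars_restrict) (auto simp: disjoint_family_on_def)
  then have "indep_vars (\<lambda>_. borel) (\<lambda>n \<omega>. ?g n (restrict (\<lambda>k. panel_family k \<omega>) (?K n))) UNIV"
    by (rule indep_vars_compose2) measurable
  then show ?thesis by (simp add: lag_weight_def[abs_def])
qed

lemma distr_lag_weight:
  "distr M borel (lag_weight t i) = distr M borel (\<lambda>\<omega>. a0 \<omega> ^ nat \<bar>t\<bar> / (1 - (a0 \<omega>)\<^sup>2))"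
proof -
  let ?g = "\<lambda>x::real. x ^ nat \<bar>t\<bar> / (1 - x\<^sup>2)"
  have "distr M borel (?g \<circ> a i) = distr (distr M borel (a i)) borel ?g"
    by (rule distr_distr[symmetric]) measurable
  also have "\<dots> = distr M borel (?g \<circ> a0)"
    unfolding coefficient_law by (rule distr_distr) measurable
  finally show ?thesis by (simp add: o_def lag_weight_def[abs_def])
qed

lemma lag_clt_sum_power2:
  "integrable M (\<lambda>\<omega>. (lag_clt_sum t N \<omega>)\<^sup>2)" "expectation (\<lambda>\<omega>. (lag_clt_sum t N \<omega>)\<^sup>2) \<le> lag_var t"
proof -
  let ?W = "\<lambda>i \<omega>. lag_weight t i \<omega> - lag_mean t"
  have int2: "integrable M (\<lambda>\<omega>. (?W i \<omega>)\<^sup>2)" for i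
    using lag_weight_moments[of t i] by (simp add: power2_diff)
  have var: "expectation (\<lambda>\<omega>. (?W i \<omega>)\<^sup>2) = lag_var t" for i
    using lag_weight_moments(3,4)[of t i] by simp
  have orth: "expectation (\<lambda>\<omega>. ?W i \<omega> * ?W j \<omega>) = 0" if "i \<noteq> j" for i j
  proof -
    have m: "?W i \<in> borel_measurable (panel_sigma {Inl i})" for i
      using panel_sigma_coefficient[of i "{Inl i}"] unfolding lag_weight_def by simp
    have "indep_var borel (?W i) borel (?W j)"
      by (rule indep_var_panel_sigma[OF _ m m]) (use that in auto)
    from indep_var_lebesgue_integral[OF this] lag_weight_moments show ?thesis
      by (simp add: prob_space)
  qed
  have S: "integrable M (\<lambda>\<omega>. (\<Sum>i\<in>{1..int N}. ?W i \<omega>)\<^sup>2)"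
    by (rule integrable_power2_sum) (use int2 in auto)
  have ES: "expectation (\<lambda>\<omega>. (\<Sum>i\<in>{1..int N}. ?W i \<omega>)\<^sup>2) = real N * lag_var t"
    by (subst integral_power2_sum_orthogonal[OF _ _ int2 orth]) (auto simp: var)
  show "integrable M (\<lambda>\<omega>. (lag_clt_sum t N \<omega>)\<^sup>2)"
    using S by (simp add: lag_clt_sum_def power_divide)
  have "expectation (\<lambda>\<omega>. (lag_clt_sum t N \<omega>)\<^sup>2) = real N * lag_var t / real N"
    by (simp add: lag_clt_sum_def power_divide ES)
  \<comment> \<open>Equality holds for \<open>N > 0\<close>; for \<open>N = 0\<close> division by
    zero makes the left side 0.\<close>
  then show "expectation (\<lambda>\<omega>. (lag_clt_sum t N \<omega>)\<^sup>2) \<le> lag_var t"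
    using lag_var_nonneg by simp
qed

text \<open>The classical theorem requires positive variance. If the variance vanishes, the sum is
  almost surely 0, which agrees with the limit.\<close>

lemma lag_clt_sum_weak_convergence:
  fixes g :: "real \<Rightarrow> real"
  assumes Z_space: "prob_space M'" and Z: "distributed M' lborel Z std_normal_density"
    and g: "continuous_on UNIV g" and bdd: "bounded (range g)"
  shows "(\<lambda>N. expectation (\<lambda>\<omega>. g (lag_clt_sum t N \<omega>))) \<longlonglongrightarrow> (\<integral>\<omega>. g (sqrt (lag_var t) * Z \<omega>) \<partial>M')"
proof (cases "lag_var t = 0")
  case True
  interpret M': prob_space M' by fact
  have "AE \<omega> in M. lag_weight t i \<omega> - lag_mean t = 0" for i
  proof -
    have "integrable M (\<lambda>\<omega>. (lag_weight t i \<omega> - lag_mean t)\<^sup>2)"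
      using lag_weight_moments[of t i] by (simp add: power2_diff)
    moreover have "expectation (\<lambda>\<omega>. (lag_weight t i \<omega> - lag_mean t)\<^sup>2) = 0"
      using lag_weight_moments(3,4)[of t i] True by simp
    ultimately have "AE \<omega> in M. (lag_weight t i \<omega> - lag_mean t)\<^sup>2 = 0"
      by (subst integral_nonneg_eq_0_iff_AE[symmetric]) auto
    then show ?thesis by simp
  qed
  then have all0: "AE \<omega> in M. \<forall>i\<in>{1..int N}. lag_weight t i \<omega> - lag_mean t = 0" for N
    by (intro AE_finite_allI) auto
  have "AE \<omega> in M. g (lag_clt_sum t N \<omega>) = g 0" for N
    using all0[of N] by eventually_elim (simp add: lag_clt_sum_def)
  moreover have gm[measurable]: "g \<in> borel_measurable borel"
    using g by (rule borel_measurable_continuous_onI)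
  ultimately have "expectation (\<lambda>\<omega>. g (lag_clt_sum t N \<omega>)) = expectation (\<lambda>\<omega>. g 0)" for N
    by (intro integral_cong_AE) auto
  then show ?thesis using True by (simp add: prob_space M'.prob_space)
next
  case False
  define \<sigma> where "\<sigma> = sqrt (lag_var t)"
  have \<sigma>: "\<sigma> > 0" "\<sigma>\<^sup>2 = lag_var t" using False lag_var_nonneg[of t] by (auto simp: \<sigma>_def)
  \<comment> \<open>The theorem normalizes by \<open>sqrt (N * \<sigma> ^ 2)\<close>; rescaling the
    test function puts \<open>\<sigma>\<close> back.\<close>
  define h where "h x = g (\<sigma> * x)" for x
  have h: "continuous_on UNIV h" unfolding h_def[abs_def]
    by (intro continuous_on_compose2[OF g] continuous_intros) auto
  then have hm[measurable]: "h \<in> borel_measurable borel" by (rule borel_measurable_continuous_onI)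
  from bdd obtain B where B: "\<And>x. norm (g x) \<le> B" unfolding bounded_iff by auto
  let ?S = "\<lambda>N \<omega>. (\<Sum>n<N. lag_weight t (int n + 1) \<omega> - lag_mean t) / sqrt (real N * \<sigma>\<^sup>2)"
  have S_eq: "lag_clt_sum t N \<omega> = \<sigma> * ?S N \<omega>" for N \<omega>
    using \<sigma>(1) by (simp add: lag_clt_sum_def sum_int_eq_sum_nat real_sqrt_mult)
  have [measurable]: "?S N \<in> borel_measurable M" for N by measurable
  have conv: "weak_conv_m (\<lambda>N. distr M borel (?S N)) std_normal_distribution"
    by (rule central_limit_theorem[OF indep_lag_weight lag_weight_moments(3) \<sigma>(1) lag_weight_moments(1) _ distr_lag_weight])
       (simp add: lag_weight_moments(4) \<sigma>(2))
  have "(\<lambda>N. integral\<^sup>L (distr M borel (?S N)) h) \<longlonglongrightarrow> integral\<^sup>L std_normal_distribution h"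
  proof (rule weak_conv_imp_integral_bdd_continuous_conv[OF _ _ conv])
    show "real_distribution (distr M borel (?S N))" for N by (rule real_distribution_distr) simp
    show "real_distribution std_normal_distribution" by (rule real_dist_normal_dist)
    show "isCont h x" for x using h by (simp add: continuous_on_eq_continuous_at)
    show "norm (h x) \<le> B" for x using B by (simp add: h_def)
  qed
  moreover have "integral\<^sup>L (distr M borel (?S N)) h = expectation (\<lambda>\<omega>. g (lag_clt_sum t N \<omega>))" for N
    unfolding S_eq by (subst integral_distr) (auto simp: h_def)
  moreover have "integral\<^sup>L std_normal_distribution h = (\<integral>\<omega>. g (\<sigma> * Z \<omega>) \<partial>M')"
  proof -
    have Zm: "Z \<in> measurable M' lborel" using Z by (rule distributed_measurable)
    have "std_normal_distribution = distr M' lborel Z"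
      using distributed_distr_eq_density[OF Z] by simp
    then have "integral\<^sup>L std_normal_distribution h = integral\<^sup>L (distr M' lborel Z) h" by simp
    also have "\<dots> = (\<integral>\<omega>. h (Z \<omega>) \<partial>M')" by (rule integral_distr[OF Zm]) simp
    finally show ?thesis by (simp add: h_def)
  qed
  ultimately show ?thesis by (simp add: \<sigma>_def)
qed

section \<open>Comparison of the normalized sum with the central limit sum\<close>

abbreviation S :: "int \<Rightarrow> nat \<Rightarrow> nat \<Rightarrow> real \<Rightarrow> 'a \<Rightarrow> real" where
  "S t \<equiv> lagged_product_sum X t"

definition normalized_sum :: "int \<Rightarrow> nat \<times> nat \<Rightarrow> real \<Rightarrow> 'a \<Rightarrow> real" where
  "normalized_sum t = (\<lambda>(N, n) \<tau> \<omega>. (S t N n \<tau> \<omega> - expectation (S t N n \<tau>)) / (real n * sqrt (real N)))"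

lemma lagged_product_sum_measurable [measurable]: "S t N n \<tau> \<in> borel_measurable M"
  unfolding lagged_product_sum_def[abs_def] by measurable

lemma normalized_sum_measurable [measurable]: "normalized_sum t k \<tau> \<in> borel_measurable M"
  unfolding normalized_sum_def by (cases k) simp

lemma integrable_centred_products_power2: "finite U \<Longrightarrow> integrable M (\<lambda>\<omega>. (centred_products t U i \<omega>)\<^sup>2)"
  unfolding centred_products_def using lagged_products_L2[of 1 t] by auto

text \<open>Separates the fluctuation within units, to be shown negligible, from the conditional
  means, which depend on \<open>\<tau>\<close> only through the factor
  \<open>card U / n\<close>.\<close>

lemma normalized_sum_eq:
  fixes \<tau> :: real and n :: nat
  defines "U \<equiv> {1..\<lfloor>real n * \<tau>\<rfloor>}"
  shows "normalized_sum t (N, n) \<tau> \<omega>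
    = (\<Sum>i\<in>{1..int N}. centred_products t U i \<omega> - expectation (centred_products t U i)) / (real n * sqrt (real N))
      + real (card U) / real n * lag_clt_sum t N \<omega>"
proof -
  let ?T = "centred_products t U"
  have intT: "integrable M (?T i)" for i
    by (rule square_integrable_imp_integrable[OF _ integrable_centred_products_power2])
       (simp_all add: U_def)
  have S_eq: "S t N n \<tau> = (\<lambda>\<omega>. \<Sum>i\<in>{1..int N}. ?T i \<omega> + real (card U) * lag_weight t i \<omega>)"
    by (simp add: lagged_product_sum_def centred_products_def U_def sum_subtractf fun_eq_iff)
  have ES: "expectation (S t N n \<tau>) = (\<Sum>i\<in>{1..int N}. expectation (?T i) + real (card U) * lag_mean t)"
    unfolding S_eq using intT lag_weight_moments by simp
  have "S t N n \<tau> \<omega> - expectation (S t N n \<tau>)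
      = (\<Sum>i\<in>{1..int N}. (?T i \<omega> - expectation (?T i)) + real (card U) * (lag_weight t i \<omega> - lag_mean t))"
    unfolding ES unfolding S_eq sum_subtractf[symmetric] by (intro sum.cong refl) (simp add: algebra_simps)
  also have "\<dots> = (\<Sum>i\<in>{1..int N}. ?T i \<omega> - expectation (?T i))
      + real (card U) * (\<Sum>i\<in>{1..int N}. lag_weight t i \<omega> - lag_mean t)"
    by (simp only: sum.distrib sum_distrib_left)
  finally show ?thesis
    by (simp add: normalized_sum_def lag_clt_sum_def add_divide_distrib)
qed

text \<open>The factor \<open>N\<close> from summing variances over units cancels against the
  squared normalization, leaving a bound in \<open>n\<close> alone. Integrability is given for every
  \<open>n\<close>, as the Slutsky argument asks for it at each index.\<close>

lemma normalized_sum_minus_clt_sum_power2: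
  assumes \<tau>: "\<tau> \<ge> 0"
    and C: "C \<ge> 0"
    and bound: "\<And>i U. finite U \<Longrightarrow> expectation (\<lambda>\<omega>. (centred_products t U i \<omega>)\<^sup>2)
      \<le> \<delta> * (real (card U))\<^sup>2 + C * real (card U)" and \<delta>: "\<delta> \<ge> 0"
  shows "integrable M (\<lambda>\<omega>. (normalized_sum t (N, n) \<tau> \<omega> - \<tau> * lag_clt_sum t N \<omega>)\<^sup>2)"
    and "n \<ge> 1 \<Longrightarrow> expectation (\<lambda>\<omega>. (normalized_sum t (N, n) \<tau> \<omega> - \<tau> * lag_clt_sum t N \<omega>)\<^sup>2)
      \<le> 2 * (\<delta> * \<tau>\<^sup>2) + (2 * (C * \<tau>) * inverse (real n) + 2 * lag_var t * (inverse (real n))\<^sup>2)"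
proof -
  define U where "U = {1..\<lfloor>real n * \<tau>\<rfloor>}"
  define m where "m = real (card U)"
  have U: "finite U" by (simp add: U_def)
  define R where "R \<omega> = (\<Sum>i\<in>{1..int N}. centred_products t U i \<omega> - expectation (centred_products t U i))" for \<omega>
  define V where "V = lag_clt_sum t N"
  have [measurable]: "R \<in> borel_measurable M" "V \<in> borel_measurable M"
    unfolding R_def[abs_def] V_def by measurable
  have R: "integrable M (\<lambda>\<omega>. (R \<omega>)\<^sup>2)" "expectation (\<lambda>\<omega>. (R \<omega>)\<^sup>2) \<le> real N * (\<delta> * m\<^sup>2 + C * m)"
    using expectation_square_sum_centred_le[of "{1..int N}" U t, OF _ U integrable_centred_products_power2[OF U] bound[OF U]]
    by (simp_all add: R_def m_def)
  have V: "integrable M (\<lambda>\<omega>. (V \<omega>)\<^sup>2)" "expectation (\<lambda>\<omega>. (V \<omega>)\<^sup>2) \<le> lag_var t"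
    using lag_clt_sum_power2 by (simp_all add: V_def)
  have eq: "normalized_sum t (N, n) \<tau> \<omega> - \<tau> * lag_clt_sum t N \<omega>
      = R \<omega> / (real n * sqrt (real N)) + (m / real n - \<tau>) * V \<omega>" for \<omega>
    unfolding normalized_sum_eq R_def U_def m_def V_def by (simp add: algebra_simps)
  let ?B = "\<lambda>\<omega>. 2 * ((R \<omega>)\<^sup>2 / ((real n)\<^sup>2 * real N)) + 2 * ((m / real n - \<tau>)\<^sup>2 * (V \<omega>)\<^sup>2)"
  have pw: "(normalized_sum t (N, n) \<tau> \<omega> - \<tau> * lag_clt_sum t N \<omega>)\<^sup>2 \<le> ?B \<omega>" for \<omega>
  proof -
    have "(x + y)\<^sup>2 \<le> 2 * x\<^sup>2 + 2 * y\<^sup>2" for x y :: real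
      using sum_squares_bound[of x y] by (simp only: power2_sum)
    from this[of "R \<omega> / (real n * sqrt (real N))" "(m / real n - \<tau>) * V \<omega>"]
    show ?thesis unfolding eq by (simp only: power_divide power_mult_distrib real_sqrt_pow2 of_nat_0_le_iff)
  qed
  have intB: "integrable M ?B" using R V by simp
  show int: "integrable M (\<lambda>\<omega>. (normalized_sum t (N, n) \<tau> \<omega> - \<tau> * lag_clt_sum t N \<omega>)\<^sup>2)"
    by (rule integrable_bounded_by[OF intB]) (use pw in \<open>auto simp: V_def\<close>)
  assume n: "n \<ge> 1"
  \<comment> \<open>As \<open>\<tau> \<ge> 0\<close>, the number of summands is the floor itself,
    within 1 of \<open>n * \<tau>\<close>.\<close>
  have m: "0 \<le> m" "m \<le> real n * \<tau>" "real n * \<tau> - 1 \<le> m"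
  proof -
    have "0 \<le> \<lfloor>real n * \<tau>\<rfloor>" using \<tau> by simp
    then have "m = real_of_int \<lfloor>real n * \<tau>\<rfloor>" by (simp add: m_def U_def)
    then show "m \<le> real n * \<tau>" "real n * \<tau> - 1 \<le> m" by linarith+
  qed (simp add: m_def)
  have "real N * (\<delta> * m\<^sup>2 + C * m) / ((real n)\<^sup>2 * real N) \<le> (\<delta> * m\<^sup>2 + C * m) / (real n)\<^sup>2"
    \<comment> \<open>For \<open>N = 0\<close> the left side is 0 by the convention on division by
      zero.\<close>
    using m C \<delta> by (cases "N = 0") auto
  also have "\<dots> \<le> (\<delta> * (real n * \<tau>)\<^sup>2 + C * (real n * \<tau>)) / (real n)\<^sup>2"
    using m C \<delta> by (intro divide_right_mono add_mono mult_left_mono power_mono) auto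
  also have "\<dots> = \<delta> * \<tau>\<^sup>2 + C * \<tau> * inverse (real n)"
    using n by (simp add: field_simps power2_eq_square)
  finally have 1: "expectation (\<lambda>\<omega>. (R \<omega>)\<^sup>2) / ((real n)\<^sup>2 * real N) \<le> \<delta> * \<tau>\<^sup>2 + C * \<tau> * inverse (real n)"
    using divide_right_mono[OF R(2), of "(real n)\<^sup>2 * real N"] by simp
  have "\<bar>m / real n - \<tau>\<bar> \<le> inverse (real n)"
  proof -
    have "\<bar>m - real n * \<tau>\<bar> \<le> 1" using m by linarith
    moreover have "m / real n - \<tau> = (m - real n * \<tau>) / real n" using n by (simp add: field_simps)
    ultimately show ?thesis using n by (simp add: abs_divide inverse_eq_divide divide_right_mono)
  qed
  then have "(m / real n - \<tau>)\<^sup>2 \<le> (inverse (real n))\<^sup>2" by (simp add: abs_le_square_iff[symmetric])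
  then have 2: "(m / real n - \<tau>)\<^sup>2 * expectation (\<lambda>\<omega>. (V \<omega>)\<^sup>2) \<le> (inverse (real n))\<^sup>2 * lag_var t"
    using V(2) by (intro mult_mono) auto
  have "expectation (\<lambda>\<omega>. (normalized_sum t (N, n) \<tau> \<omega> - \<tau> * lag_clt_sum t N \<omega>)\<^sup>2) \<le> expectation ?B"
    by (rule integral_mono[OF int intB pw])
  also have "\<dots> = 2 * (expectation (\<lambda>\<omega>. (R \<omega>)\<^sup>2) / ((real n)\<^sup>2 * real N))
      + 2 * ((m / real n - \<tau>)\<^sup>2 * expectation (\<lambda>\<omega>. (V \<omega>)\<^sup>2))"
    using R V by simp
  also have "\<dots> \<le> 2 * (\<delta> * \<tau>\<^sup>2 + C * \<tau> * inverse (real n)) + 2 * ((inverse (real n))\<^sup>2 * lag_var t)"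
    using 1 2 by (intro add_mono mult_left_mono) auto
  finally show "expectation (\<lambda>\<omega>. (normalized_sum t (N, n) \<tau> \<omega> - \<tau> * lag_clt_sum t N \<omega>)\<^sup>2)
      \<le> 2 * (\<delta> * \<tau>\<^sup>2) + (2 * (C * \<tau>) * inverse (real n) + 2 * lag_var t * (inverse (real n))\<^sup>2)"
    by (simp add: algebra_simps)
qed

lemma centred_products_L2_bound:
  assumes "\<delta> > 0"
  obtains C where "C \<ge> 0" "\<And>i U. finite U \<Longrightarrow> expectation (\<lambda>\<omega>. (centred_products t U i \<omega>)\<^sup>2)
      \<le> \<delta> * (real (card U))\<^sup>2 + C * real (card U)"
  using lagged_products_L2[OF assms, of t] unfolding centred_products_def by blast

text \<open>The bound does not involve \<open>N\<close>, so being eventually small in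
  \<open>n\<close> is enough along the product filter.\<close>

lemma normalized_sum_minus_clt_sum_L2_tendsto:
  assumes \<tau>: "\<tau> \<ge> 0"
  shows "((\<lambda>k. expectation (\<lambda>\<omega>. (normalized_sum t k \<tau> \<omega> - \<tau> * lag_clt_sum t (fst k) \<omega>)\<^sup>2)) \<longlongrightarrow> 0)
    (sequentially \<times>\<^sub>F sequentially)"
proof (rule tendstoI)
  fix e :: real assume e: "e > 0"
  \<comment> \<open>Ensures \<open>2 * \<delta> * \<tau> ^ 2 \<le> e / 2\<close>; adding 1 covers
    \<open>\<tau> = 0\<close>. The terms with \<open>1 / n\<close> take the other half.\<close>
  define \<delta> where "\<delta> = (e / 4) / (\<tau>\<^sup>2 + 1)"
  have pos: "\<tau>\<^sup>2 + 1 > 0" by (simp add: add_nonneg_pos)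
  then have \<delta>: "\<delta> > 0" using e by (simp add: \<delta>_def)
  have small: "2 * (\<delta> * \<tau>\<^sup>2) \<le> e / 2"
  proof -
    have "\<delta> * \<tau>\<^sup>2 \<le> \<delta> * (\<tau>\<^sup>2 + 1)" using \<delta> by simp
    also have "\<dots> = e / 4" using pos unfolding \<delta>_def by (intro nonzero_divide_eq_eq[THEN iffD1, symmetric]) auto
    finally show ?thesis by simp
  qed
  obtain C where C: "C \<ge> 0" and bound: "\<And>i U. finite U \<Longrightarrow> expectation (\<lambda>\<omega>. (centred_products t U i \<omega>)\<^sup>2)
      \<le> \<delta> * (real (card U))\<^sup>2 + C * real (card U)"
    using centred_products_L2_bound[OF \<delta>, of t] by blast
  have "(\<lambda>n. 2 * (C * \<tau>) * inverse (real n) + 2 * lag_var t * (inverse (real n))\<^sup>2)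
      \<longlonglongrightarrow> 2 * (C * \<tau>) * 0 + 2 * lag_var t * 0\<^sup>2"
    by (intro tendsto_intros lim_inverse_n)
  then have "\<forall>\<^sub>F n in sequentially. 2 * (C * \<tau>) * inverse (real n) + 2 * lag_var t * (inverse (real n))\<^sup>2 < e / 2"
    using e by (intro order_tendstoD(2)) auto
  with eventually_ge_at_top[of 1]
  have ev: "\<forall>\<^sub>F n in sequentially. n \<ge> 1 \<and>
      2 * (C * \<tau>) * inverse (real n) + 2 * lag_var t * (inverse (real n))\<^sup>2 < e / 2"
    by (rule eventually_conj)
  have "\<forall>\<^sub>F k in sequentially \<times>\<^sub>F sequentially. snd k \<ge> 1 \<and>
      2 * (C * \<tau>) * inverse (real (snd k)) + 2 * lag_var t * (inverse (real (snd k)))\<^sup>2 < e / 2"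
    by (rule eventually_compose_filterlim[OF ev filterlim_snd])
  then show "\<forall>\<^sub>F k in sequentially \<times>\<^sub>F sequentially.
      dist (expectation (\<lambda>\<omega>. (normalized_sum t k \<tau> \<omega> - \<tau> * lag_clt_sum t (fst k) \<omega>)\<^sup>2)) 0 < e"
  proof eventually_elim
    case (elim k)
    obtain N n where k: "k = (N, n)" by (cases k)
    have "0 \<le> expectation (\<lambda>\<omega>. (normalized_sum t k \<tau> \<omega> - \<tau> * lag_clt_sum t (fst k) \<omega>)\<^sup>2)"
      by (rule Bochner_Integration.integral_nonneg) simp
    then show ?case
      using normalized_sum_minus_clt_sum_power2(2)[OF \<tau> C bound, of n N] \<delta> small elim
      by (simp add: k dist_real_def)
  qed
qed

text \<open>The central limit sum depends on the first index only, so its weak convergence transfers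
  to the product filter by projection.\<close>

lemma normalized_sum_fdd_converges:
  assumes Z_space: "prob_space M'" and Z: "distributed M' lborel Z std_normal_density"
  shows "fdd_converges {0..} (sequentially \<times>\<^sub>F sequentially) M (normalized_sum t)
    M' (\<lambda>\<tau> \<omega>. \<tau> * sqrt (lag_var t) * Z \<omega>)"
proof -
  have [measurable]: "Z \<in> borel_measurable M'" using distributed_measurable[OF Z] by simp
  have "fdd_converges {0..} (sequentially \<times>\<^sub>F sequentially) M (normalized_sum t)
      M' (\<lambda>\<tau> \<omega>. \<tau> * (sqrt (lag_var t) * Z \<omega>))"
  proof (rule fdd_converges_if_L2_close[where V = "\<lambda>k. lag_clt_sum t (fst k)" and K = "lag_var t"])
    fix k :: "nat \<times> nat" and \<tau> :: real
    assume "\<tau> \<in> {0..}"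
    then have \<tau>: "\<tau> \<ge> 0" by simp
    \<comment> \<open>Only integrability is at stake here, so the tolerance is set to 1.\<close>
    obtain C where C: "C \<ge> 0" and bound: "\<And>i U. finite U \<Longrightarrow> expectation (\<lambda>\<omega>. (centred_products t U i \<omega>)\<^sup>2)
      \<le> 1 * (real (card U))\<^sup>2 + C * real (card U)"
      using centred_products_L2_bound[of 1 t] by (metis zero_less_one)
    show "integrable M (\<lambda>\<omega>. (normalized_sum t k \<tau> \<omega> - \<tau> * lag_clt_sum t (fst k) \<omega>)\<^sup>2)"
      using normalized_sum_minus_clt_sum_power2(1)[OF \<tau> C bound, of "fst k" "snd k"] by simp
  next
    fix \<tau> :: real assume "\<tau> \<in> {0..}"
    then show "((\<lambda>k. expectation (\<lambda>\<omega>. (normalized_sum t k \<tau> \<omega> - \<tau> * lag_clt_sum t (fst k) \<omega>)\<^sup>2)) \<longlongrightarrow> 0)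
        (sequentially \<times>\<^sub>F sequentially)"
      by (intro normalized_sum_minus_clt_sum_L2_tendsto) simp
  next
    fix g :: "real \<Rightarrow> real" assume "continuous_on UNIV g" "bounded (range g)"
    from filterlim_compose[OF lag_clt_sum_weak_convergence[OF Z_space Z this] filterlim_fst]
    show "((\<lambda>k. expectation (\<lambda>\<omega>. g (lag_clt_sum t (fst k) \<omega>))) \<longlongrightarrow> (\<integral>\<omega>. g (sqrt (lag_var t) * Z \<omega>) \<partial>M'))
        (sequentially \<times>\<^sub>F sequentially)" .
  qed (auto intro: lag_clt_sum_power2)
  then show ?thesis by (simp add: mult.assoc)
qed

end

theorem theorem4p2:
  fixes M :: "'a measure" and M' :: "'b measure"
    and \<epsilon> :: "int \<Rightarrow> int \<Rightarrow> 'a \<Rightarrow> real" and a :: "int \<Rightarrow> 'a \<Rightarrow> real"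
    and \<epsilon>0 a0 :: "'a \<Rightarrow> real" and Z :: "'b \<Rightarrow> real"
    and \<beta> :: real and t :: int
    and S :: "nat \<Rightarrow> nat \<Rightarrow> real \<Rightarrow> 'a \<Rightarrow> real" and \<sigma> :: real
  assumes model: "panel_model M \<epsilon> a \<epsilon>0 a0"
    and mixing: "mixing_density M a0 \<beta>" and beta: "\<beta> > 2"
    and fourth_moment: "integrable M (\<lambda>\<omega>. \<epsilon>0 \<omega> ^ 4)"
    and Z_space: "prob_space M'" and Z_normal: "distributed M' lborel Z std_normal_density"
  defines "S \<equiv> lagged_product_sum (panel_X \<epsilon> a) t"
    and "\<sigma> \<equiv> sqrt (prob_space.variance M (\<lambda>\<omega>. a0 \<omega> ^ nat \<bar>t\<bar> / (1 - (a0 \<omega>)\<^sup>2)))"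
  shows "fdd_converges {0..} (sequentially \<times>\<^sub>F sequentially)
           M (\<lambda>(N, n) \<tau> \<omega>. (S N n \<tau> \<omega> - prob_space.expectation M (S N n \<tau>)) / (real n * sqrt (real N)))
           M' (\<lambda>\<tau> \<omega>'. \<tau> * \<sigma> * Z \<omega>')"
proof -
  interpret panel_model M \<epsilon> a \<epsilon>0 a0 by (rule model)
  have "integrable M (\<lambda>\<omega>. 1 / (1 - (a0 \<omega>)\<^sup>2)\<^sup>2)"
    by (rule mixing_density_imp_integrable[OF mixing beta coefficient_rv generic_coefficient_range])
  then interpret panel_model_moments M \<epsilon> a \<epsilon>0 a0
    by unfold_locales (rule fourth_moment)
  show ?thesis
    using normalized_sum_fdd_converges[OF Z_space Z_normal, of t]
    unfolding S_def \<sigma>_def normalized_sum_def lag_var_def .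
qed

end
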